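(* Let $D,F,M$ be positive integers, and consider the degree-$D$ code $\mathcal{E}$ (defined in the context) for $F$ fermions in $M$ modes, with $L=2DF\lceil\log_2(M+1)\rceil+1$. For a Bravyi-Kitaev bit $i$, let $S_i$ be the set of the $L$ qubits that are $1$ in the $i$-th elementary codeword, and let $\mathcal{E}(Z_i^{(BK)})$ be the operation acting on each computational basis state $|q\rangle$ of the code qubits by $$\mathcal{E}(Z_i^{(BK)})|q\rangle=\begin{cases}|q\rangle&\text{if } z_i>0,\\-|q\rangle&\text{if } z_i<0,\end{cases}\qquad\text{where the integer } z_i \text{ is defined by } \sum_{j\in S_i}Z_j|q\rangle=z_i|q\rangle.$$ Then $\mathcal{E}(Z_i^{(BK)})$ can be implemented using $$L(2L-1)=8D^2F^2\lceil\log_2(M+1)\rceil^2+6DF\lceil\log_2(M+1)\rceil+1=O(D^2F^2\log^2M)$$ controlled phases and single-qubit gates, and one ancilla qubit.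
   Context: $Z_j$ is the Pauli-$Z$ operator on code qubit $j$. Since $|S_i|=L$ is odd, $z_i\neq0$; $z_i<0$ exactly when more than half of the qubits in $S_i$ are $1$. Bravyi-Kitaev (BK) mapping: an occupation number state of $M$ fermionic modes is represented by a bitstring $b$ of $M$ bits (the BK bits), each the parity of a subset of the mode occupations; the map is linear over $\mathbb{F}_2$ and invertible, and a state of at most $F$ fermions has a BK bitstring of Hamming weight at most $G=F\lceil\log_2(M+1)\rceil$. $Z_i^{(BK)}$ is the Pauli-$Z$ operator acting on the $i$-th BK bit. Degree-$D$ code: $L=2DG+1$, and $L'$ is the least prime with $L'\ge L$ and $(L')^{D+1}\ge M$. There are $Q=L'L$ code qubits, arranged in $L$ blocks of $L'$ qubits. To each BK bit $i$ is assigned a polynomial function $y_i$ of degree at most $D$ over $\mathbb{Z}_{L'}$, distinct for distinct $i$; the $i$-th elementary codeword has in each block $x\in\{0,\dots,L-1\}$ a single $1$, at position $y_i(x)$. A BK bitstring of Hamming weight at most $G$ is encoded as the bitwise sum (mod 2) of the elementary codewords of its $1$s, and this is extended linearly to superpositions. With this code, the $i$-th BK bit is $1$ if and only if more than half of the qubits in $S_i$ are $1$, so the operation above is the encoding of $Z_i^{(BK)}$. Arbitrary qubit connectivity is assumed. *)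

theory Defs
  imports
    "HOL-Computational_Algebra.Computational_Algebra"
    "HOL-Library.Landau_Symbols"
    "Jordan_Normal_Form.Schur_Decomposition"
begin

section \<open>Degree-\<open>D\<close> codes\<close>

definition code_length :: "nat \<Rightarrow> nat \<Rightarrow> nat \<Rightarrow> nat" where
  "code_length D F M = 2 * D * F * nat \<lceil>log 2 (real M + 1)\<rceil> + 1"

definition block_size :: "nat \<Rightarrow> nat \<Rightarrow> nat \<Rightarrow> nat" where
  "block_size D F M = (LEAST p. prime p \<and> code_length D F M \<le> p \<and> M \<le> p ^ (D + 1))"

definition num_qubits :: "nat \<Rightarrow> nat \<Rightarrow> nat \<Rightarrow> nat" where
  "num_qubits D F M = block_size D F M * code_length D F M"

text \<open>Residues modulo \<open>p\<close> are represented by \<open>0, \<dots>, p - 1\<close>.  The functions are made extensional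
  by \<^term>\<open>restrict\<close>, so that HOL equality is equality of functions on residues.\<close>

definition polynomial_functions :: "nat \<Rightarrow> nat \<Rightarrow> (nat \<Rightarrow> nat) set" where
  "polynomial_functions D p =
     {(\<lambda>x\<in>{..<p}. nat (poly P (int x) mod int p)) | P :: int poly. degree P \<le> D}"

text \<open>The \<open>M\<close> Bravyi-Kitaev bits are numbered \<open>0, \<dots>, M - 1\<close>; \<open>y i\<close> is the polynomial function
  assigned to bit \<open>i\<close>, and the assignment determines the code.\<close>

definition degree_code :: "nat \<Rightarrow> nat \<Rightarrow> nat \<Rightarrow> (nat \<Rightarrow> nat \<Rightarrow> nat) \<Rightarrow> bool" where
  "degree_code D F M y \<longleftrightarrow>
     y ` {..<M} \<subseteq> polynomial_functions D (block_size D F M) \<and> inj_on y {..<M}"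

text \<open>Qubit \<open>j\<close> sits in block \<open>j div block_size D F M\<close> at position \<open>j mod block_size D F M\<close>.\<close>

definition elementary_codeword ::
    "nat \<Rightarrow> nat \<Rightarrow> nat \<Rightarrow> (nat \<Rightarrow> nat \<Rightarrow> nat) \<Rightarrow> nat \<Rightarrow> nat \<Rightarrow> bool" where
  "elementary_codeword D F M y i j \<longleftrightarrow>
     j < num_qubits D F M \<and> y i (j div block_size D F M) = j mod block_size D F M"

definition codeword_support ::
    "nat \<Rightarrow> nat \<Rightarrow> nat \<Rightarrow> (nat \<Rightarrow> nat \<Rightarrow> nat) \<Rightarrow> nat \<Rightarrow> nat set" where
  "codeword_support D F M y i = {j. elementary_codeword D F M y i j}"


section \<open>Qubit registers\<close>

text \<open>The state space of \<open>n\<close> qubits is \<^term>\<open>carrier_vec (2 ^ n) :: complex vec set\<close>.  The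
  computational basis state in which qubit \<open>j\<close> has value \<open>bit q j\<close> is \<open>ket n q\<close>.\<close>

definition ket :: "nat \<Rightarrow> nat \<Rightarrow> complex vec" where
  "ket n q = unit_vec (2 ^ n) q"

text \<open>The operator \<open>I \<otimes> \<dots> \<otimes> U \<otimes> \<dots> \<otimes> I\<close> on \<open>n\<close> qubits, with the \<open>2 \<times> 2\<close> matrix \<open>U\<close> on qubit \<open>j\<close>.\<close>

definition on_qubit :: "nat \<Rightarrow> nat \<Rightarrow> complex mat \<Rightarrow> complex mat" where
  "on_qubit n j U = mat (2 ^ n) (2 ^ n) (\<lambda>(r, c).
     if \<forall>k<n. k \<noteq> j \<longrightarrow> bit r k = bit c k
     then U $$ (of_bool (bit r j), of_bool (bit c j)) else 0)"

definition controlled_phase :: "nat \<Rightarrow> nat \<Rightarrow> nat \<Rightarrow> real \<Rightarrow> complex mat" where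
  "controlled_phase n j k \<phi> = mat (2 ^ n) (2 ^ n) (\<lambda>(r, c).
     if r = c then (if bit r j \<and> bit r k then cis \<phi> else 1) else 0)"

definition pauli_Z :: "nat \<Rightarrow> nat \<Rightarrow> complex mat" where
  "pauli_Z n j = on_qubit n j (mat_of_rows_list 2 [[1, 0], [0, -1]])"

definition z_value :: "nat \<Rightarrow> nat set \<Rightarrow> nat \<Rightarrow> int" where
  "z_value n S q = (THE z :: int.
     finsum_vec TYPE(complex) (2 ^ n) (\<lambda>j. pauli_Z n j *\<^sub>v ket n q) S = of_int z \<cdot>\<^sub>v ket n q)"

text \<open>The value \<open>0\<close> is never taken when \<open>S\<close> has odd cardinality.\<close>

definition sign_Z :: "nat \<Rightarrow> nat set \<Rightarrow> complex mat" where
  "sign_Z n S = mat (2 ^ n) (2 ^ n) (\<lambda>(r, q).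
     if r = q then (if z_value n S q > 0 then 1 else if z_value n S q < 0 then -1 else 0) else 0)"

definition encoded_Z ::
    "nat \<Rightarrow> nat \<Rightarrow> nat \<Rightarrow> (nat \<Rightarrow> nat \<Rightarrow> nat) \<Rightarrow> nat \<Rightarrow> complex mat" where
  "encoded_Z D F M y i = sign_Z (num_qubits D F M) (codeword_support D F M y i)"


section \<open>Circuits\<close>

datatype gate = Single_Qubit nat "complex mat" | Controlled_Phase nat nat real

fun valid_gate :: "nat \<Rightarrow> gate \<Rightarrow> bool" where
  "valid_gate n (Single_Qubit j U) \<longleftrightarrow>
     j < n \<and> U \<in> carrier_mat 2 2 \<and> mat_adjoint U * U = 1\<^sub>m 2"
| "valid_gate n (Controlled_Phase j k \<phi>) \<longleftrightarrow> j < n \<and> k < n \<and> j \<noteq> k"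

fun gate_mat :: "nat \<Rightarrow> gate \<Rightarrow> complex mat" where
  "gate_mat n (Single_Qubit j U) = on_qubit n j U"
| "gate_mat n (Controlled_Phase j k \<phi>) = controlled_phase n j k \<phi>"

text \<open>The first gate of the list is applied first.\<close>

fun circuit_mat :: "nat \<Rightarrow> gate list \<Rightarrow> complex mat" where
  "circuit_mat n [] = 1\<^sub>m (2 ^ n)"
| "circuit_mat n (g # gs) = circuit_mat n gs * gate_mat n g"

text \<open>The circuit acts on \<open>n\<close> qubits and \<open>a\<close> ancilla qubits, numbered \<open>n, \<dots>, n + a - 1\<close>.  The
  ancillas start in \<open>|0\<rangle>\<close> and are returned to it.  As they carry the most significant bits of a basis
  index, \<open>\<psi> \<otimes> |0\<dots>0\<rangle>\<close> is \<open>\<psi>\<close> padded with zeros.\<close>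

definition implements :: "nat \<Rightarrow> nat \<Rightarrow> gate list \<Rightarrow> complex mat \<Rightarrow> bool" where
  "implements n a gs A \<longleftrightarrow>
     (\<forall>g\<in>set gs. valid_gate (n + a) g) \<and>
     (\<forall>\<psi>\<in>carrier_vec (2 ^ n).
        circuit_mat (n + a) gs *\<^sub>v (\<psi> @\<^sub>v 0\<^sub>v (2 ^ (n + a) - 2 ^ n)) =
        (A *\<^sub>v \<psi>) @\<^sub>v 0\<^sub>v (2 ^ (n + a) - 2 ^ n))"

end

theory Submission
  imports "HOL-Analysis.Complex_Analysis_Basics" Defs
begin

text \<open>Let \<open>L = 2h - 1\<close> be the number of qubits in the support, \<open>w\<close> the number of them that are \<open>1\<close>, and
  \<open>\<zeta> = exp (\<pi>\<i>/h)\<close>, \<open>\<omega> = \<zeta>\<^sup>2\<close>. The circuit is quantum signal processing on the ancilla. There is a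
  Fejer-type interpolation polynomial \<open>P\<close> of degree at most \<open>L - 1\<close>, bounded by \<open>1\<close> on the unit
  circle, with \<open>P(\<omega>\<^sup>w) = \<zeta>\<^sup>-\<^sup>w\<close> for \<open>w < h\<close>. Since \<open>\<zeta>\<^sup>h = -1\<close> while \<open>\<omega>\<^sup>h = 1\<close>, the product
  \<open>\<zeta>\<^sup>w P(\<omega>\<^sup>w)\<close> is \<open>1\<close> for \<open>w < h\<close> and \<open>-1\<close> for \<open>h \<le> w < 2h\<close>. The Fejer-Riesz theorem completes
  \<open>P\<close> to a pair with \<open>|P|\<^sup>2 + |Q|\<^sup>2 = 1\<close> on the circle, and peeling off one degree at a time
  factors \<open>(P, Q)\<close> into \<open>L\<close> ancilla rotations separated by \<open>L - 1\<close> layers of \<open>L\<close> controlled phases.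
  The factor \<open>\<zeta>\<^sup>w\<close> costs one phase gate on each of the \<open>L\<close> qubits. This makes \<open>L\<^sup>2 + L \<le> L(2L - 1)\<close>
  gates; the count is made exact with identity gates.\<close>

section \<open>Polynomials on the unit circle\<close>

text \<open>The circle contains all \<open>n\<close> of the \<open>n\<close>-th roots of unity for
  every \<open>n > 0\<close>, so no finite cardinality suffices.\<close>

lemma infinite_unit_circle: "infinite {z :: complex. norm z = 1}"
proof
  assume fin: "finite {z :: complex. norm z = 1}"
  define n where "n = Suc (card {z :: complex. norm z = 1})"
  have "{z :: complex. z ^ n = 1} \<subseteq> {z. norm z = 1}"
    using power_eq_1_iff by (fastforce simp: n_def simp del: power_Suc)
  then have "card {z :: complex. z ^ n = 1} \<le> card {z :: complex. norm z = 1}"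
    using fin by (rule card_mono[rotated])
  moreover have "card {z :: complex. z ^ n = 1} = n"
    by (rule card_roots_unity_eq) (simp add: n_def)
  ultimately show False by (simp add: n_def)
qed

text \<open>Turns identities known only on the circle, where conjugation is tractable, into
  identities of coefficients: a nonzero difference would have infinitely many roots.\<close>

lemma poly_eqI_unit_circle:
  fixes p q :: "complex poly"
  assumes "\<And>z. norm z = 1 \<Longrightarrow> poly p z = poly q z"
  shows "p = q"
proof (rule ccontr)
  assume "p \<noteq> q"
  then have "finite {z. poly (p - q) z = 0}"
    by (intro poly_roots_finite) simp
  moreover have "{z. norm z = 1} \<subseteq> {z. poly (p - q) z = 0}"
    using assms by auto
  ultimately show False
    using infinite_unit_circle finite_subset by blast
qed

lemma inverse_unit_circle:
  fixes z :: complex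
  assumes "norm z = 1"
  shows "z * cnj z = 1" "cnj z * z = 1" "1 / cnj z = z" "1 / z = cnj z" "z \<noteq> 0"
proof -
  show 1: "z * cnj z = 1" using assms by (simp add: complex_norm_square[symmetric])
  then show "cnj z * z = 1" by (simp add: mult.commute)
  show "z \<noteq> 0" using assms by auto
  with 1 show "1 / cnj z = z" "1 / z = cnj z" by (auto simp: field_simps)
qed

text \<open>The conjugate reciprocal polynomial, relative to a degree bound \<open>d\<close>. On the
  circle it is \<open>z ^ d\<close> times the conjugate of \<open>p\<close>, so it makes
  \<open>|p|^2\<close> polynomial up to a factor \<open>z ^ d\<close>.\<close>

definition conj_reflect :: "nat \<Rightarrow> complex poly \<Rightarrow> complex poly" where
  "conj_reflect d p = (\<Sum>j\<le>d. monom (cnj (coeff p (d - j))) j)"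

lemma coeff_conj_reflect:
  "coeff (conj_reflect d p) j = (if j \<le> d then cnj (coeff p (d - j)) else 0)"
  by (simp add: conj_reflect_def coeff_sum coeff_monom if_distrib sum.delta cong: if_cong)

lemma degree_conj_reflect: "degree (conj_reflect d p) \<le> d"
  by (rule degree_le) (simp add: coeff_conj_reflect)

lemma poly_conj_reflect:
  assumes "degree p \<le> d" and "z \<noteq> 0"
  shows "poly (conj_reflect d p) z = z ^ d * cnj (poly p (1 / cnj z))"
proof -
  have "poly p (1 / cnj z) = (\<Sum>i\<le>d. coeff p i * (1 / cnj z) ^ i)"
    using arg_cong[OF poly_as_sum_of_monoms'[OF assms(1)], of "\<lambda>p. poly p (1 / cnj z)"]
    by (simp add: poly_sum poly_monom)
  then have "z ^ d * cnj (poly p (1 / cnj z)) = (\<Sum>i\<le>d. cnj (coeff p i) * (z ^ d * (1 / z) ^ i))"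
    by (simp add: sum_distrib_left mult_ac)
  also have "\<dots> = (\<Sum>i\<le>d. cnj (coeff p i) * z ^ (d - i))"
    using assms(2) by (intro sum.cong) (auto simp: power_diff field_simps power_one_over)
  also have "\<dots> = (\<Sum>j\<le>d. cnj (coeff p (d - j)) * z ^ j)"
    by (rule sum.reindex_bij_witness[of _ "\<lambda>j. d - j" "\<lambda>j. d - j"]) auto
  also have "\<dots> = poly (conj_reflect d p) z"
    by (simp add: conj_reflect_def poly_sum poly_monom)
  finally show ?thesis by simp
qed

lemma poly_conj_reflect_unit_circle:
  assumes "degree p \<le> d" and "norm z = 1"
  shows "poly (conj_reflect d p) z = z ^ d * cnj (poly p z)"
  using poly_conj_reflect[OF assms(1), of z] inverse_unit_circle[OF assms(2)] by simp

section \<open>Fejer-Riesz factorization and completion to a unit pair\<close>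

text \<open>Along \<open>z = cis t\<close> the expression is real and nonnegative, so a zero is a
  minimum and the derivative vanishes there. That derivative is a nonzero multiple of
  \<open>poly (pderiv H) a\<close>.\<close>

lemma double_root_unit_circle:
  fixes H :: "complex poly"
  assumes nonneg: "\<And>z. norm z = 1 \<Longrightarrow> cnj z ^ m * poly H z \<in> \<real>\<^sub>\<ge>\<^sub>0"
    and a: "norm a = 1" "poly H a = 0"
  shows "poly (pderiv H) a = 0"
proof -
  obtain t where t: "a = cis t"
    using a(1) by (metis complex_norm_square cis_Arg norm_zero sgn_eq sgn_div_norm scaleR_one inverse_1 zero_neq_one)
  \<comment> \<open>Writing \<open>cnj z\<close> as an exponential gives a function of a complex
    variable, open to complex differentiation, that agrees with the given expression on the real
    line.\<close>
  define g where "g = (\<lambda>x :: complex. exp (- (\<i> * of_nat m * x)) * poly H (exp (\<i> * x)))"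
  define D where "D = exp (- (\<i> * of_nat m * of_real t)) * (poly (pderiv H) a * (a * \<i>))"
  have ex: "exp (\<i> * complex_of_real x) = cis x" for x
    by (simp add: cis_conv_exp mult.commute)
  have exm: "exp (- (\<i> * of_nat m * complex_of_real x)) = cnj (cis x) ^ m" for x
  proof -
    have "exp (- (\<i> * of_nat m * complex_of_real x)) = exp (of_nat m * (- (\<i> * complex_of_real x)))"
      by (simp add: mult_ac)
    also have "\<dots> = exp (- (\<i> * complex_of_real x)) ^ m" by (rule exp_of_nat_mult)
    also have "exp (- (\<i> * complex_of_real x)) = cis (- x)"
      by (simp add: cis_conv_exp mult.commute)
    also have "\<dots> = cnj (cis x)" by (rule cis_cnj[symmetric])
    finally show ?thesis .
  qed
  have g: "g (of_real x) \<in> \<real>\<^sub>\<ge>\<^sub>0" for x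
    unfolding g_def ex exm by (rule nonneg) simp
  have g0: "g (of_real t) = 0" by (simp add: g_def ex t[symmetric] a(2))
  have 1: "((\<lambda>x. poly H (exp (\<i> * x))) has_field_derivative poly (pderiv H) a * (a * \<i>)) (at (of_real t))"
    unfolding t ex[symmetric]
    by (rule DERIV_chain2[OF poly_DERIV]) (auto intro!: derivative_eq_intros)
  have 2: "((\<lambda>x. exp (- (\<i> * of_nat m * x))) has_field_derivative
      exp (- (\<i> * of_nat m * of_real t)) * - (\<i> * of_nat m)) (at (of_real t))"
    by (auto intro!: derivative_eq_intros)
  have "(g has_field_derivative D) (at (of_real t))"
    using DERIV_mult[OF 2 1] by (simp add: g_def[abs_def] D_def ex t[symmetric] a(2) mult_ac)
  then have "((\<lambda>x. g (of_real x)) has_vector_derivative D) (at t)"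
    by (rule has_vector_derivative_real_field)
  then have re: "((\<lambda>x. Re (g (of_real x))) has_real_derivative Re D) (at t)"
    and im: "((\<lambda>x. Im (g (of_real x))) has_real_derivative Im D) (at t)"
    by (auto simp: has_vector_derivative_complex_iff)
  have "Re D = 0"
    by (rule DERIV_local_min[OF re, of 1])
       (use g g0 in \<open>auto simp: complex_nonneg_Reals_iff\<close>)
  moreover have "Im D = 0"
    by (rule DERIV_local_min[OF im, of 1])
       (use g g0 in \<open>auto simp: complex_nonneg_Reals_iff\<close>)
  ultimately have "D = 0" by (simp add: complex_eq_iff)
  then show ?thesis using a(1) by (auto simp: D_def)
qed

text \<open>Dividing by \<open>|z - a|^2\<close> says nothing at \<open>z = a\<close>; the missing
  value is a limit along nearby points of the circle.\<close>

lemma nonneg_unit_circle_closure: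
  fixes H :: "complex poly"
  assumes nonneg: "\<And>z. norm z = 1 \<Longrightarrow> z \<noteq> a \<Longrightarrow> cnj z ^ m * poly H z \<in> \<real>\<^sub>\<ge>\<^sub>0"
    and a: "norm a = 1"
  shows "cnj a ^ m * poly H a \<in> \<real>\<^sub>\<ge>\<^sub>0"
proof -
  define s where "s = (\<lambda>k. a * cis (1 / real (Suc k)))"
  have "s \<longlonglongrightarrow> a * cis 0"
    unfolding s_def by (intro tendsto_intros LIMSEQ_Suc lim_1_over_n)
  then have s: "s \<longlonglongrightarrow> a" by simp
  have ne: "s k \<noteq> a" for k
  proof -
    have "sin (1 / real (Suc k)) > 0"
    proof (rule sin_gt_zero)
      have "1 / real (Suc k) \<le> 1" by simp
      then show "1 / real (Suc k) < pi" using pi_ge_two by linarith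
    qed simp
    then have "cis (1 / real (Suc k)) \<noteq> 1" by (auto simp: complex_eq_iff)
    then show ?thesis using a by (auto simp: s_def)
  qed
  have "(\<lambda>k. cnj (s k) ^ m * poly H (s k)) \<longlonglongrightarrow> cnj a ^ m * poly H a"
    by (intro tendsto_intros s)
  moreover have "cnj (s k) ^ m * poly H (s k) \<in> \<real>\<^sub>\<ge>\<^sub>0" for k
    by (rule nonneg[OF _ ne]) (simp add: s_def norm_mult a)
  ultimately show ?thesis
    using closed_sequentially[OF closed_nonneg_Reals_complex] by fast
qed

text \<open>On the circle \<open>cnj z = 1/z\<close>, so \<open>cnj z ^ m * poly H z\<close> is a Laurent polynomial. Roots are split
  off in pairs \<open>a\<close>, \<open>1 / cnj a\<close>, which coincide for \<open>a\<close> on the circle.\<close>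

theorem fejer_riesz:
  fixes H :: "complex poly"
  assumes "degree H \<le> 2 * m"
    and "\<And>z. norm z = 1 \<Longrightarrow> cnj z ^ m * poly H z \<in> \<real>\<^sub>\<ge>\<^sub>0"
  shows "\<exists>g. degree g \<le> m \<and>
           (\<forall>z. norm z = 1 \<longrightarrow> cnj z ^ m * poly H z = of_real ((norm (poly g z))\<^sup>2))"
  using assms
proof (induction m arbitrary: H)
  case 0
  then obtain c where c: "H = [:c:]" by (auto elim: degree_eq_zeroE)
  with 0(2)[of 1] have "c \<in> \<real>\<^sub>\<ge>\<^sub>0" by simp
  then obtain r where r: "r \<ge> 0" "c = of_real r" by (auto simp: nonneg_Reals_def)
  show ?case
    by (rule exI[of _ "[:of_real (sqrt r):]"]) (use r c in auto)
next
  case (Suc m)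
  define n where "n = Suc m"
  \<comment> \<open>A real Laurent polynomial equals its conjugate on the circle, so
    \<open>H\<close> is its own conjugate reciprocal. Hence the extreme coefficients are conjugate
    and a root \<open>a \<noteq> 0\<close> comes with the root \<open>1 / cnj a\<close>.\<close>
  have sym: "conj_reflect (2 * n) H = H"
  proof (rule poly_eqI_unit_circle)
    fix z :: complex assume z: "norm z = 1"
    have zn: "z ^ n * cnj z ^ n = 1"
      by (simp add: power_mult_distrib[symmetric] inverse_unit_circle[OF z])
    have "cnj (cnj z ^ n * poly H z) = cnj z ^ n * poly H z"
      using Suc.prems(2)[OF z] unfolding n_def by (metis complex_cnj_complex_of_real nonneg_Reals_cases)
    then have "cnj (cnj z ^ n) * cnj (poly H z) = cnj z ^ n * poly H z"
      by (simp only: complex_cnj_mult)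
    then have "z ^ n * (z ^ n * cnj (poly H z)) = (z ^ n * cnj z ^ n) * poly H z"
      by (simp only: complex_cnj_power complex_cnj_cnj mult.assoc)
    moreover have "poly (conj_reflect (2 * n) H) z = z ^ n * (z ^ n * cnj (poly H z))"
      using poly_conj_reflect_unit_circle[OF Suc.prems(1) z]
      by (simp only: n_def mult_2 power_add mult.assoc)
    ultimately show "poly (conj_reflect (2 * n) H) z = poly H z"
      by (simp only: zn mult_1)
  qed
  have top: "coeff H (2 * n) = cnj (coeff H 0)"
    using coeff_conj_reflect[of "2 * n" H "2 * n"] by (simp add: sym)
  show ?case
  proof (cases "coeff H 0 = 0")
    case True
    obtain c K where K: "H = pCons c K" by (cases H)
    have H: "H = pCons 0 K" using True K by simp
    \<comment> \<open>Dividing by \<open>z\<close> lowers the degree bound by one; the vanishing of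
      \<open>coeff H (2 * n)\<close>, conjugate to \<open>coeff H 0\<close>, lowers it once
      more.\<close>
    have deg: "degree K \<le> 2 * m"
    proof (rule degree_le, intro allI impI)
      fix i assume i: "2 * m < i"
      have "coeff H (Suc i) = 0"
      proof (cases "Suc i = 2 * n")
        case True then show ?thesis using top \<open>coeff H 0 = 0\<close> by simp
      next
        case False
        then have "degree H < Suc i" using i Suc.prems(1) by (simp add: n_def)
        then show ?thesis by (rule coeff_eq_0)
      qed
      then show "coeff K i = 0" by (simp add: H)
    qed
    have eq: "cnj z ^ Suc m * poly H z = cnj z ^ m * poly K z" if "norm z = 1" for z
      using inverse_unit_circle(2)[OF that] by (simp add: H mult_ac)
    from Suc.IH[OF deg] Suc.prems(2) eq obtain g where
      "degree g \<le> m" "\<forall>z. norm z = 1 \<longrightarrow> cnj z ^ m * poly K z = of_real ((norm (poly g z))\<^sup>2)"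
      by metis
    then show ?thesis using eq by (intro exI[of _ g]) auto
  next
    case False
    then have degH: "degree H = 2 * n"
      using top Suc.prems(1) by (intro antisym le_degree) (auto simp: n_def)
    then have "\<not> constant (poly H)" by (simp add: constant_degree n_def)
    then obtain a where a: "poly H a = 0" using fundamental_theorem_of_algebra by blast
    have a0: "a \<noteq> 0" using a False by (auto simp: poly_0_coeff_0)
    define b where "b = 1 / cnj a"
    have "[:-a, 1:] * [:-b, 1:] dvd H"
    proof (cases "norm a = 1")
      case True
      then have "b = a" by (simp add: b_def inverse_unit_circle)
      obtain K where K: "H = [:-a, 1:] * K" using a unfolding poly_eq_0_iff_dvd dvd_def by blast
      have "poly (pderiv H) a = 0"
        by (rule double_root_unit_circle[OF Suc.prems(2) True a])
      moreover have "pderiv H = [:-a, 1:] * pderiv K + K"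
        unfolding K pderiv_mult by (simp add: pderiv_pCons)
      ultimately have "poly K a = 0" by simp
      then obtain K' where K': "K = [:-b, 1:] * K'"
        unfolding \<open>b = a\<close> poly_eq_0_iff_dvd dvd_def by blast
      show ?thesis unfolding K K' by (rule dvdI[of _ _ K']) (simp only: mult.assoc)
    next
      case False
      have "poly H b = 0"
        using poly_conj_reflect[of H "2 * n" b] degH a a0 by (simp add: sym b_def)
      have "a \<noteq> b"
      proof
        assume "a = b"
        then have "a * cnj a = 1" using a0 by (simp add: b_def field_simps)
        then have "complex_of_real ((norm a)\<^sup>2) = of_real 1" by (simp only: complex_norm_square) simp
        then have "(norm a)\<^sup>2 = 1" by (simp only: of_real_eq_iff)
        then show False using False by (simp add: power2_eq_1_iff) (use norm_ge_zero[of a] in linarith)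
      qed
      obtain K where K: "H = [:-a, 1:] * K" using a unfolding poly_eq_0_iff_dvd dvd_def by blast
      have "poly K b = 0" using \<open>poly H b = 0\<close> \<open>a \<noteq> b\<close> by (simp add: K)
      then obtain K' where K': "K = [:-b, 1:] * K'"
        unfolding poly_eq_0_iff_dvd dvd_def by blast
      show ?thesis unfolding K K' by (rule dvdI[of _ _ K']) (simp only: mult.assoc)
    qed
    then obtain K where K: "H = [:-a, 1:] * [:-b, 1:] * K" unfolding dvd_def by blast
    \<comment> \<open>On the circle \<open>|z - a|^2 = - cnj a * cnj z * (z - a) * (z - b)\<close>.
      The scalar absorbs the constant, so the two linear factors and one power of
      \<open>cnj z\<close> combine to \<open>|z - a|^2\<close>.\<close>
    define H2 where "H2 = Polynomial.smult (- 1 / cnj a) K"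
    have "K \<noteq> 0"
    proof
      assume "K = 0"
      with False show False by (simp add: K)
    qed
    then have "degree H = 2 + degree K"
      unfolding K by (simp add: degree_mult_eq del: mult_pCons_left mult_pCons_right)
    then have deg2: "degree H2 \<le> 2 * m" using degH by (simp add: H2_def n_def)
    have eq: "cnj z ^ Suc m * poly H z = of_real ((norm (z - a))\<^sup>2) * (cnj z ^ m * poly H2 z)"
      if z: "norm z = 1" for z
    proof -
      have zc: "z * cnj z = 1" by (rule inverse_unit_circle[OF z])
      have "of_real ((norm (z - a))\<^sup>2) = (z - a) * (cnj z - cnj a)"
        by (simp only: complex_norm_square complex_cnj_diff)
      also have "cnj z - cnj a = cnj z * (1 - cnj a * z)"
        using zc by (simp add: algebra_simps)
      also have "1 - cnj a * z = - cnj a * (z - b)"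
        using a0 by (simp add: b_def field_simps)
      finally have "of_real ((norm (z - a))\<^sup>2) = (z - a) * (cnj z * (- cnj a * (z - b)))" .
      moreover have "poly H2 z = - (poly K z / cnj a)" by (simp add: H2_def)
      moreover have "poly H z = (z - a) * (z - b) * poly K z" by (simp add: K algebra_simps)
      ultimately have "of_real ((norm (z - a))\<^sup>2) * poly H2 z = cnj z * poly H z"
        using a0 by simp
      then show ?thesis by (simp add: mult_ac)
    qed
    have nn': "cnj z ^ m * poly H2 z \<in> \<real>\<^sub>\<ge>\<^sub>0" if z: "norm z = 1" "z \<noteq> a" for z
    proof -
      have "(norm (z - a))\<^sup>2 > 0" using z by simp
      moreover have "of_real ((norm (z - a))\<^sup>2) * (cnj z ^ m * poly H2 z) \<in> \<real>\<^sub>\<ge>\<^sub>0"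
        using Suc.prems(2)[OF z(1)] unfolding eq[OF z(1)] .
      ultimately show ?thesis
        by (simp add: complex_nonneg_Reals_iff zero_le_mult_iff del: of_real_power)
    qed
    have nn: "cnj z ^ m * poly H2 z \<in> \<real>\<^sub>\<ge>\<^sub>0" if z: "norm z = 1" for z
      using nn' nonneg_unit_circle_closure[of a m H2] z by blast
    from Suc.IH[OF deg2 nn] obtain g where g: "degree g \<le> m"
      "\<And>z. norm z = 1 \<Longrightarrow> cnj z ^ m * poly H2 z = of_real ((norm (poly g z))\<^sup>2)"
      by blast
    show ?thesis
    proof (intro exI[of _ "[:-a, 1:] * g"] conjI allI impI)
      show "degree ([:-a, 1:] * g) \<le> Suc m"
        using degree_mult_le[of "[:-a, 1:]" g] g(1) by simp
      fix z :: complex assume z: "norm z = 1"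
      show "cnj z ^ Suc m * poly H z = of_real ((norm (poly ([:-a, 1:] * g) z))\<^sup>2)"
      proof -
        have "poly ([:-a, 1:] * g) z = (z - a) * poly g z" by (simp add: algebra_simps)
        then show ?thesis
          unfolding eq[OF z] g(2)[OF z] by (simp only: norm_mult power_mult_distrib of_real_mult)
      qed
    qed
  qed
qed

text \<open>On the circle \<open>1 - |P|^2\<close> is a nonnegative Laurent polynomial, formed with
  the conjugate reciprocal of \<open>P\<close>; Fejer-Riesz writes it as
  \<open>|Q|^2\<close>.\<close>

lemma unitary_completion:
  fixes P :: "complex poly"
  assumes "degree P \<le> d" and "\<And>z. norm z = 1 \<Longrightarrow> norm (poly P z) \<le> 1"
  shows "\<exists>Q. degree Q \<le> d \<and>
           (\<forall>z. norm z = 1 \<longrightarrow> (norm (poly P z))\<^sup>2 + (norm (poly Q z))\<^sup>2 = 1)"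
proof -
  define H where "H = monom 1 d - P * conj_reflect d P"
  have "degree (P * conj_reflect d P) \<le> 2 * d"
    using degree_mult_le[of P "conj_reflect d P"] degree_conj_reflect[of d P] assms(1) by linarith
  then have deg: "degree H \<le> 2 * d"
    unfolding H_def by (intro degree_diff_le) (simp_all add: degree_monom_eq)
  have eq: "cnj z ^ d * poly H z = of_real (1 - (norm (poly P z))\<^sup>2)" if z: "norm z = 1" for z
  proof -
    have "poly H z = z ^ d * (1 - poly P z * cnj (poly P z))"
      by (simp add: H_def poly_monom poly_conj_reflect_unit_circle[OF assms(1) z] algebra_simps)
    then have "cnj z ^ d * poly H z = (cnj z * z) ^ d * (1 - poly P z * cnj (poly P z))"
      by (simp add: power_mult_distrib)
    then show ?thesis
      by (simp only: inverse_unit_circle[OF z] complex_norm_square of_real_diff of_real_1 power_one mult_1)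
  qed
  have "cnj z ^ d * poly H z \<in> \<real>\<^sub>\<ge>\<^sub>0" if z: "norm z = 1" for z
    unfolding eq[OF z] using assms(2)[OF z] by (simp add: power_le_one del: of_real_diff of_real_power)
  from fejer_riesz[OF deg this] obtain Q where Q: "degree Q \<le> d"
    "\<And>z. norm z = 1 \<Longrightarrow> cnj z ^ d * poly H z = of_real ((norm (poly Q z))\<^sup>2)"
    by blast
  have "(norm (poly P z))\<^sup>2 + (norm (poly Q z))\<^sup>2 = 1" if z: "norm z = 1" for z
  proof -
    have "1 - (norm (poly P z))\<^sup>2 = (norm (poly Q z))\<^sup>2"
      using Q(2)[OF z] unfolding eq[OF z] of_real_eq_iff .
    then show ?thesis by simp
  qed
  with Q(1) show ?thesis by blast
qed


section \<open>An interpolation polynomial for the majority sign\<close>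

lemma sum_powers_root_of_unity:
  fixes x :: complex
  assumes "x ^ h = 1"
  shows "(\<Sum>k<h. x ^ k) = (if x = 1 then of_nat h else 0)"
  using assms by (auto simp: geometric_sum)

lemma cis_root_eq_iff:
  assumes "a < h" "b < h"
  shows "cis (2 * pi / real h) ^ a = cis (2 * pi / real h) ^ b \<longleftrightarrow> a = b"
proof -
  have "inj_on (\<lambda>k. cis (2 * pi * real k / real h)) {..<h}"
    using Complex.bij_betw_roots_unity[of h] assms by (auto simp: bij_betw_def)
  moreover have "cis (2 * pi / real h) ^ k = cis (2 * pi * real k / real h)" for k
    by (simp add: Complex.DeMoivre mult_ac)
  ultimately show ?thesis using assms by (auto simp: inj_on_def)
qed

text \<open>A Lagrange interpolant of unimodular values may exceed modulus \<open>1\<close> between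
  the nodes. Squaring the basis polynomials avoids this and doubles the degree from
  \<open>h - 1\<close> to \<open>2 * (h - 1)\<close>.\<close>

lemma sign_interpolating_polynomial:
  assumes "h > 0"
  shows "\<exists>P. degree P \<le> 2 * (h - 1) \<and> (\<forall>z. norm z = 1 \<longrightarrow> norm (poly P z) \<le> 1) \<and>
           (\<forall>w<2 * h. cis (pi / real h) ^ w * poly P (cis (2 * pi / real h) ^ w) =
              (if w < h then 1 else -1))"
proof -
  define \<omega> where "\<omega> = cis (2 * pi / real h)"
  define \<zeta> where "\<zeta> = cis (pi / real h)"
  \<comment> \<open>\<open>E k / h\<close> is the Lagrange polynomial of \<open>\<omega>\<^sup>k\<close> on the \<open>h\<close>-th roots of unity; squaring keeps its
    values there and gives \<open>|P| \<le> 1\<close> by Parseval.\<close>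
  define E where "E k = (\<Sum>j<h. monom (cnj \<omega> ^ (k * j)) j)" for k
  define P where "P = (\<Sum>k<h. Polynomial.smult (cnj \<zeta> ^ k / of_nat (h ^ 2)) ((E k)\<^sup>2))"
  have n\<omega>: "norm \<omega> = 1" and n\<zeta>: "norm \<zeta> = 1" by (simp_all add: \<omega>_def \<zeta>_def)
  have \<omega>1: "\<omega> * cnj \<omega> = 1" and \<zeta>1: "\<zeta> * cnj \<zeta> = 1"
    by (simp_all add: inverse_unit_circle n\<omega> n\<zeta>)
  have \<omega>h: "\<omega> ^ h = 1" using assms by (simp add: \<omega>_def Complex.DeMoivre)
  then have c\<omega>h: "cnj \<omega> ^ h = 1" by (metis complex_cnj_power complex_cnj_one)
  have \<zeta>h: "\<zeta> ^ h = -1" using assms by (simp add: \<zeta>_def Complex.DeMoivre)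
  \<comment> \<open>The base is an \<open>h\<close>-th root of unity, equal to \<open>1\<close> only
    for \<open>a = b\<close>. This serves both Parseval and the values at the nodes.\<close>
  have orth: "(\<Sum>k<h. (cnj \<omega> ^ a * \<omega> ^ b) ^ k) = (if a = b then of_nat h else 0)"
    if "a < h" "b < h" for a b
  proof -
    have "(cnj \<omega> ^ a * \<omega> ^ b) ^ h = (cnj \<omega> ^ h) ^ a * (\<omega> ^ h) ^ b"
      by (simp add: power_mult_distrib power_mult[symmetric] mult.commute)
    then have "(cnj \<omega> ^ a * \<omega> ^ b) ^ h = 1" by (simp add: \<omega>h c\<omega>h)
    moreover have "cnj \<omega> ^ a * \<omega> ^ b = 1 \<longleftrightarrow> \<omega> ^ b = \<omega> ^ a"
    proof -
      have "\<omega> ^ a * cnj \<omega> ^ a = 1" by (simp add: power_mult_distrib[symmetric] \<omega>1)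
      then show ?thesis
        by (metis mult.assoc mult.commute mult_1 mult_1_right)
    qed
    moreover have "\<omega> ^ b = \<omega> ^ a \<longleftrightarrow> a = b"
      unfolding \<omega>_def using cis_root_eq_iff[OF that(2,1)] by blast
    ultimately show ?thesis by (simp add: sum_powers_root_of_unity)
  qed
  have polyE: "poly (E k) z = (\<Sum>j<h. cnj \<omega> ^ (k * j) * z ^ j)" for k z
    by (simp add: E_def poly_sum poly_monom)
  have polyP: "poly P z = (\<Sum>k<h. cnj \<zeta> ^ k / of_nat (h ^ 2) * (poly (E k) z)\<^sup>2)" for z
    by (simp add: P_def poly_sum)
  have parseval: "(\<Sum>k<h. (norm (poly (E k) z))\<^sup>2) = real (h ^ 2)" if z: "norm z = 1" for z
  proof -
    have zz: "z ^ j * cnj z ^ j = 1" for j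
      by (simp add: power_mult_distrib[symmetric] inverse_unit_circle[OF z])
    have "complex_of_real (\<Sum>k<h. (norm (poly (E k) z))\<^sup>2) = (\<Sum>k<h. poly (E k) z * cnj (poly (E k) z))"
      by (simp only: of_real_sum complex_norm_square)
    also have "\<dots> = (\<Sum>k<h. \<Sum>j<h. \<Sum>l<h. (z ^ j * cnj z ^ l) * (cnj \<omega> ^ j * \<omega> ^ l) ^ k)"
    proof (rule sum.cong[OF refl])
      fix k
      have 1: "cnj (poly (E k) z) = (\<Sum>l<h. \<omega> ^ (k * l) * cnj z ^ l)" by (simp add: polyE)
      show "poly (E k) z * cnj (poly (E k) z) =
          (\<Sum>j<h. \<Sum>l<h. (z ^ j * cnj z ^ l) * (cnj \<omega> ^ j * \<omega> ^ l) ^ k)"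
        unfolding 1 unfolding polyE sum_product
        by (intro sum.cong refl) (simp add: power_mult_distrib power_mult[symmetric] mult_ac)
    qed
    also have "\<dots> = (\<Sum>j<h. \<Sum>l<h. \<Sum>k<h. (z ^ j * cnj z ^ l) * (cnj \<omega> ^ j * \<omega> ^ l) ^ k)"
      by (subst sum.swap) (rule sum.cong[OF refl sum.swap])
    also have "\<dots> = (\<Sum>j<h. \<Sum>l<h. (z ^ j * cnj z ^ l) * (if j = l then of_nat h else 0))"
      by (intro sum.cong refl) (simp add: sum_distrib_left[symmetric] orth)
    also have "\<dots> = (\<Sum>j<h. of_nat h)"
      by (intro sum.cong refl) (simp add: if_distrib zz sum.delta cong: if_cong)
    also have "\<dots> = complex_of_real (real (h ^ 2))" by (simp add: power2_eq_square)
    finally show ?thesis by (simp only: of_real_eq_iff)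
  qed
  have "degree P \<le> 2 * (h - 1)"
  proof -
    have "degree (E k) \<le> h - 1" for k
      unfolding E_def by (intro degree_sum_le) (auto intro: order.trans[OF degree_monom_le])
    then have "degree ((E k)\<^sup>2) \<le> 2 * (h - 1)" for k
      using degree_mult_le[of "E k" "E k"] by (metis add_mono mult_2 order.trans power2_eq_square)
    then show ?thesis
      unfolding P_def by (intro degree_sum_le) (auto intro: order.trans[OF degree_smult_le])
  qed
  moreover have "norm (poly P z) \<le> 1" if z: "norm z = 1" for z
  proof -
    have "norm (poly P z) \<le> (\<Sum>k<h. norm (cnj \<zeta> ^ k / of_nat (h ^ 2) * (poly (E k) z)\<^sup>2))"
      unfolding polyP by (rule norm_sum)
    also have "\<dots> = (\<Sum>k<h. (norm (poly (E k) z))\<^sup>2 / real (h ^ 2))"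
      by (intro sum.cong refl) (simp add: norm_mult norm_divide norm_power n\<zeta>)
    also have "\<dots> = 1"
      unfolding sum_divide_distrib[symmetric] parseval[OF z] using assms by simp
    finally show ?thesis .
  qed
  moreover have "\<zeta> ^ w * poly P (\<omega> ^ w) = (if w < h then 1 else -1)" if w: "w < 2 * h" for w
  proof -
    \<comment> \<open>Passing from \<open>w\<close> to \<open>w - h\<close> keeps
      \<open>\<omega> ^ w\<close> and flips the sign of \<open>\<zeta> ^ w\<close>; as
      \<open>w < 2 * h\<close>, one subtraction suffices.\<close>
    define r where "r = (if w < h then w else w - h)"
    have r: "r < h" using w by (auto simp: r_def)
    have \<omega>r: "\<omega> ^ w = \<omega> ^ r" and \<zeta>r: "\<zeta> ^ w = (if w < h then 1 else -1) * \<zeta> ^ r"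
      using power_add[of \<omega> "w - h" h] power_add[of \<zeta> "w - h" h] by (auto simp: r_def \<omega>h \<zeta>h)
    have "poly (E k) (\<omega> ^ r) = (if k = r then of_nat h else 0)" if "k < h" for k
    proof -
      have "poly (E k) (\<omega> ^ r) = (\<Sum>j<h. (cnj \<omega> ^ k * \<omega> ^ r) ^ j)"
        unfolding polyE by (simp add: power_mult_distrib power_mult)
      then show ?thesis using orth[OF that r] by simp
    qed
    then have "poly P (\<omega> ^ r) = (\<Sum>k<h. if k = r then cnj \<zeta> ^ k else 0)"
      unfolding polyP using assms by (intro sum.cong refl) simp
    also have "\<dots> = cnj \<zeta> ^ r" using r by simp
    finally show ?thesis
      using \<zeta>1 by (simp add: \<omega>r \<zeta>r power_mult_distrib[symmetric])
  qed
  ultimately show ?thesis unfolding \<omega>_def \<zeta>_def by blast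
qed

section \<open>Peeling one degree off a unit pair\<close>

text \<open>The vector \<open>(c, s)\<close> must be parallel to \<open>u\<close> and orthogonal to
  \<open>v\<close>. Normalizing \<open>u\<close> does both; if \<open>u = 0\<close>, a normalized
  vector orthogonal to \<open>v\<close> does, and if both vanish any unit vector does.\<close>

lemma orthogonal_unit_vector:
  fixes u\<^sub>0 u\<^sub>1 v\<^sub>0 v\<^sub>1 :: complex
  assumes "u\<^sub>0 * cnj v\<^sub>0 + u\<^sub>1 * cnj v\<^sub>1 = 0"
  shows "\<exists>c s. c * cnj c + s * cnj s = 1 \<and> cnj c * v\<^sub>0 + cnj s * v\<^sub>1 = 0 \<and> c * u\<^sub>1 - s * u\<^sub>0 = 0"
proof -
  have normalise: "\<exists>c s. c * cnj c + s * cnj s = 1 \<and> cnj c * v\<^sub>0 + cnj s * v\<^sub>1 = 0 \<and> c * u\<^sub>1 - s * u\<^sub>0 = 0"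
    if "x \<noteq> 0 \<or> y \<noteq> 0" "cnj x * v\<^sub>0 + cnj y * v\<^sub>1 = 0" "x * u\<^sub>1 - y * u\<^sub>0 = 0" for x y
  proof -
    define r where "r = sqrt ((norm x)\<^sup>2 + (norm y)\<^sup>2)"
    have r0: "r \<noteq> 0" using that(1) by (simp add: r_def add_nonneg_eq_0_iff)
    have "r\<^sup>2 = (norm x)\<^sup>2 + (norm y)\<^sup>2" by (simp add: r_def)
    then have "of_real (r\<^sup>2) = x * cnj x + y * cnj y"
      by (simp only: of_real_add complex_norm_square)
    then have rr: "x * cnj x + y * cnj y = of_real r * of_real r"
      by (simp add: power2_eq_square)
    show ?thesis
    proof (intro exI conjI)
      have "x / of_real r * cnj (x / of_real r) + y / of_real r * cnj (y / of_real r) =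
          (x * cnj x + y * cnj y) / (of_real r * of_real r)"
        by (simp add: add_divide_distrib)
      then show "x / of_real r * cnj (x / of_real r) + y / of_real r * cnj (y / of_real r) = 1"
        unfolding rr using r0 by simp
      have "cnj (x / of_real r) * v\<^sub>0 + cnj (y / of_real r) * v\<^sub>1 = (cnj x * v\<^sub>0 + cnj y * v\<^sub>1) / of_real r"
        by (simp add: add_divide_distrib)
      then show "cnj (x / of_real r) * v\<^sub>0 + cnj (y / of_real r) * v\<^sub>1 = 0"
        unfolding that(2) by simp
      have "x / of_real r * u\<^sub>1 - y / of_real r * u\<^sub>0 = (x * u\<^sub>1 - y * u\<^sub>0) / of_real r"
        by (simp add: diff_divide_distrib)
      then show "x / of_real r * u\<^sub>1 - y / of_real r * u\<^sub>0 = 0"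
        unfolding that(3) by simp
    qed
  qed
  have conj: "cnj u\<^sub>0 * v\<^sub>0 + cnj u\<^sub>1 * v\<^sub>1 = 0"
    using arg_cong[OF assms, of cnj] by simp
  consider "u\<^sub>0 \<noteq> 0 \<or> u\<^sub>1 \<noteq> 0" | "u\<^sub>0 = 0" "u\<^sub>1 = 0" "v\<^sub>0 \<noteq> 0 \<or> v\<^sub>1 \<noteq> 0"
    | "u\<^sub>0 = 0" "u\<^sub>1 = 0" "v\<^sub>0 = 0" "v\<^sub>1 = 0" by blast
  then show ?thesis
  proof cases
    case 1 then show ?thesis using normalise[of u\<^sub>0 u\<^sub>1] conj by simp
  next
    case 2 then show ?thesis using normalise[of "- cnj v\<^sub>1" "cnj v\<^sub>0"] by auto
  next
    case 3 then show ?thesis using normalise[of 1 0] by simp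
  qed
qed

text \<open>The top and bottom coefficients of \<open>|P|\<^sup>2 + |Q|\<^sup>2\<close> vanish, so the top coefficient vector of
  \<open>(P, Q)\<close> is orthogonal to the constant one, and a single rotation removes the former from the first
  component and the latter from the second.\<close>

lemma layer_stripping:
  fixes P Q :: "complex poly"
  assumes deg: "degree P \<le> Suc d" "degree Q \<le> Suc d"
    and unit: "\<And>z. norm z = 1 \<Longrightarrow> (norm (poly P z))\<^sup>2 + (norm (poly Q z))\<^sup>2 = 1"
  obtains c s P' Q' where
    "c * cnj c + s * cnj s = 1" "degree P' \<le> d" "degree Q' \<le> d"
    "\<And>z. norm z = 1 \<Longrightarrow> (norm (poly P' z))\<^sup>2 + (norm (poly Q' z))\<^sup>2 = 1"
    "\<And>z. poly P z = c * poly P' z - cnj s * (z * poly Q' z)"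
    "\<And>z. poly Q z = s * poly P' z + cnj c * (z * poly Q' z)"
proof -
  let ?n = "Suc d"
  have unit': "poly P z * cnj (poly P z) + poly Q z * cnj (poly Q z) = 1" if "norm z = 1" for z
    using arg_cong[OF unit[OF that], of complex_of_real]
    by (simp only: of_real_add complex_norm_square of_real_1)
  have "P * conj_reflect ?n P + Q * conj_reflect ?n Q = monom 1 ?n"
  proof (rule poly_eqI_unit_circle)
    fix z :: complex assume z: "norm z = 1"
    have "poly (P * conj_reflect ?n P + Q * conj_reflect ?n Q) z =
        z ^ ?n * (poly P z * cnj (poly P z) + poly Q z * cnj (poly Q z))"
      by (simp add: poly_conj_reflect_unit_circle[OF deg(1) z]
          poly_conj_reflect_unit_circle[OF deg(2) z] algebra_simps del: power_Suc)
    then show "poly (P * conj_reflect ?n P + Q * conj_reflect ?n Q) z = poly (monom 1 ?n) z"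
      by (simp add: unit'[OF z] poly_monom)
  qed
  from arg_cong[OF this, of "\<lambda>p. coeff p 0"]
  have "coeff P 0 * cnj (coeff P ?n) + coeff Q 0 * cnj (coeff Q ?n) = 0"
    by (simp add: coeff_mult coeff_conj_reflect)
  then obtain c s where cs: "c * cnj c + s * cnj s = 1"
    and top: "cnj c * coeff P ?n + cnj s * coeff Q ?n = 0"
    and bot: "c * coeff Q 0 - s * coeff P 0 = 0"
    using orthogonal_unit_vector by blast
  \<comment> \<open>The adjoint rotation is applied to \<open>(P, Q)\<close>. By \<open>top\<close>
    the first component loses its coefficient of degree \<open>Suc d\<close>; by \<open>bot\<close>
    the second becomes divisible by \<open>z\<close>.\<close>
  define P' where "P' = Polynomial.smult (cnj c) P + Polynomial.smult (cnj s) Q"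
  define R where "R = Polynomial.smult c Q - Polynomial.smult s P"
  obtain a Q' where "R = pCons a Q'" by (cases R)
  moreover have "coeff R 0 = 0" using bot by (simp add: R_def)
  ultimately have R: "R = pCons 0 Q'" by simp
  have degP': "degree P' \<le> d"
  proof (rule degree_le, intro allI impI)
    fix i assume "d < i"
    then consider "i = ?n" | "?n < i" by linarith
    then show "coeff P' i = 0"
      using top deg by cases (simp_all add: P'_def coeff_eq_0)
  qed
  have degQ': "degree Q' \<le> d"
  proof (rule degree_le, intro allI impI)
    fix i assume "d < i"
    then have "coeff R (Suc i) = 0" using deg by (simp add: R_def coeff_eq_0)
    then show "coeff Q' i = 0" by (simp add: R)
  qed
  have pP': "poly P' z = cnj c * poly P z + cnj s * poly Q z" for z by (simp add: P'_def)
  have pQ': "z * poly Q' z = c * poly Q z - s * poly P z" for z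
    using arg_cong[OF R, of "\<lambda>p. poly p z"] by (simp add: R_def)
  have invP: "poly P z = c * poly P' z - cnj s * (z * poly Q' z)" for z
  proof -
    have "c * poly P' z - cnj s * (z * poly Q' z) = (c * cnj c + s * cnj s) * poly P z"
      unfolding pP' pQ' by (simp add: algebra_simps)
    then show ?thesis by (simp add: cs)
  qed
  have invQ: "poly Q z = s * poly P' z + cnj c * (z * poly Q' z)" for z
  proof -
    have "s * poly P' z + cnj c * (z * poly Q' z) = (c * cnj c + s * cnj s) * poly Q z"
      unfolding pP' pQ' by (simp add: algebra_simps)
    then show ?thesis by (simp add: cs)
  qed
  have "(norm (poly P' z))\<^sup>2 + (norm (poly Q' z))\<^sup>2 = 1" if z: "norm z = 1" for z
  proof -
    have "(norm (poly P' z))\<^sup>2 + (norm (poly Q' z))\<^sup>2 =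
        (norm (poly P' z))\<^sup>2 + (norm (z * poly Q' z))\<^sup>2"
      by (simp add: norm_mult z)
    moreover have "complex_of_real ((norm (poly P' z))\<^sup>2 + (norm (z * poly Q' z))\<^sup>2) =
        (c * cnj c + s * cnj s) *
        (poly P z * cnj (poly P z) + poly Q z * cnj (poly Q z))"
      unfolding of_real_add complex_norm_square pP' pQ' by (simp add: algebra_simps)
    ultimately have "complex_of_real ((norm (poly P' z))\<^sup>2 + (norm (poly Q' z))\<^sup>2) = of_real 1"
      by (simp only: cs unit'[OF z] mult_1 of_real_1)
    then show ?thesis by (simp only: of_real_eq_iff)
  qed
  then show thesis using that[OF cs degP' degQ' _ invP invQ] by blast
qed


section \<open>Circuits with one ancilla\<close>

lemma bit_eq_if_lt_power2:
  fixes r q :: nat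
  assumes "r < 2 ^ n" "q < 2 ^ n" "\<And>k. k < n \<Longrightarrow> bit r k = bit q k"
  shows "r = q"
proof -
  have "take_bit n r = take_bit n q"
    by (rule bit_eqI) (use assms(3) in \<open>auto simp: bit_take_bit_iff\<close>)
  then show ?thesis using assms by (simp add: take_bit_nat_eq_self)
qed

lemma bit_add_power2:
  fixes q :: nat
  assumes "q < 2 ^ n"
  shows "k < n \<Longrightarrow> bit (q + 2 ^ n) k = bit q k" and "bit (q + 2 ^ n) n"
proof -
  show "bit (q + 2 ^ n) n" using assms by (simp add: bit_iff_odd)
  assume k: "k < n"
  then have "(2::nat) ^ n = 2 ^ k * 2 ^ (n - k)" by (simp add: power_add[symmetric])
  then have "(q + 2 ^ n) div 2 ^ k = q div 2 ^ k + 2 ^ (n - k)" by simp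
  then show "bit (q + 2 ^ n) k = bit q k" using k by (simp add: bit_iff_odd)
qed

lemma not_bit_if_lt_power2:
  fixes q :: nat
  assumes "q < 2 ^ n"
  shows "\<not> bit q n"
  using assms by (simp add: bit_iff_odd)

lemma ancilla_index_iff:
  fixes r q :: nat
  assumes "r < 2 ^ Suc n" "q < 2 ^ n"
  shows "(\<forall>k<n. bit r k = bit q k) \<longleftrightarrow> r = q \<or> r = q + 2 ^ n"
proof
  assume bits: "\<forall>k<n. bit r k = bit q k"
  show "r = q \<or> r = q + 2 ^ n"
  proof (cases "bit r n")
    case False
    have "r = q"
      by (rule bit_eq_if_lt_power2[of _ "Suc n"])
         (use assms bits False not_bit_if_lt_power2[OF assms(2)] in \<open>auto simp: less_Suc_eq\<close>)
    then show ?thesis ..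
  next
    case True
    have "r = q + 2 ^ n"
      by (rule bit_eq_if_lt_power2[of _ "Suc n"])
         (use assms bits True bit_add_power2[OF assms(2)] in \<open>auto simp: less_Suc_eq\<close>)
    then show ?thesis ..
  qed
qed (use bit_add_power2[OF assms(2)] in auto)

section \<open>Action of gates on the ancilla amplitudes\<close>

definition phase_gate :: "complex \<Rightarrow> complex mat" where
  "phase_gate x = mat_of_rows_list 2 [[1, 0], [0, x]]"

text \<open>For \<open>|c|^2 + |s|^2 = 1\<close> these are the matrices of SU(2);
  \<open>rotation_gate 1 0\<close> is the identity and serves as padding.\<close>

definition rotation_gate :: "complex \<Rightarrow> complex \<Rightarrow> complex mat" where
  "rotation_gate c s = mat_of_rows_list 2 [[c, - cnj s], [s, cnj c]]"

lemma unitary_phase_gate: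
  assumes "x * cnj x = 1"
  shows "phase_gate x \<in> carrier_mat 2 2" "mat_adjoint (phase_gate x) * phase_gate x = 1\<^sub>m 2"
  using assms
  by (auto simp: phase_gate_def mat_of_rows_list_def mat_adjoint_def mat_of_rows_def cols_def
      scalar_prod_def less_Suc_eq numeral_2_eq_2 mult.commute intro!: eq_matI)

lemma unitary_rotation_gate:
  assumes "c * cnj c + s * cnj s = 1"
  shows "rotation_gate c s \<in> carrier_mat 2 2"
    "mat_adjoint (rotation_gate c s) * rotation_gate c s = 1\<^sub>m 2"
  using assms
  by (auto simp: rotation_gate_def mat_of_rows_list_def mat_adjoint_def mat_of_rows_def cols_def
      scalar_prod_def less_Suc_eq numeral_2_eq_2 mult.commute add.commute intro!: eq_matI)

definition diagonal :: "nat \<Rightarrow> (nat \<Rightarrow> complex) \<Rightarrow> complex mat" where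
  "diagonal n f = mat (2 ^ n) (2 ^ n) (\<lambda>(r, c). if r = c then f r else 0)"

lemma on_qubit_phase_gate:
  assumes "j < n"
  shows "on_qubit n j (phase_gate x) = diagonal n (\<lambda>q. if bit q j then x else 1)"
  unfolding on_qubit_def diagonal_def
proof (rule cong_mat[OF refl refl])
  fix r c :: nat assume rc: "r < 2 ^ n" "c < 2 ^ n"
  have entry: "phase_gate x $$ (of_bool a, of_bool b) = (if a = b then if a then x else 1 else 0)" for a b
    by (simp add: phase_gate_def mat_of_rows_list_def)
  show "(case (r, c) of (r, c) \<Rightarrow> if \<forall>k<n. k \<noteq> j \<longrightarrow> bit r k = bit c k
           then phase_gate x $$ (of_bool (bit r j), of_bool (bit c j)) else 0) =
        (case (r, c) of (r, c) \<Rightarrow> if r = c then if bit r j then x else 1 else 0)"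
    using bit_eq_if_lt_power2[OF rc] by (auto simp: entry)
qed

lemma controlled_phase_diagonal:
  "controlled_phase n j k \<phi> = diagonal n (\<lambda>q. if bit q j \<and> bit q k then cis \<phi> else 1)"
  unfolding controlled_phase_def diagonal_def by (rule cong_mat) auto

text \<open>The ancilla is qubit \<open>n\<close>, so setting it adds \<open>2 ^ n\<close> to the
  index. The circuit acts diagonally on the data qubits, so \<open>q\<close> stays fixed and two
  amplitudes describe the state.\<close>

definition ancilla_state :: "nat \<Rightarrow> nat \<Rightarrow> complex \<Rightarrow> complex \<Rightarrow> complex vec" where
  "ancilla_state n q \<alpha> \<beta> = \<alpha> \<cdot>\<^sub>v ket (n + 1) q + \<beta> \<cdot>\<^sub>v ket (n + 1) (q + 2 ^ n)"

lemma ancilla_state_carrier: "ancilla_state n q \<alpha> \<beta> \<in> carrier_vec (2 ^ (n + 1))"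
  by (simp add: ancilla_state_def ket_def)

lemma index_mult_mat_vec_sum:
  fixes A :: "complex mat"
  assumes "A \<in> carrier_mat m n" "v \<in> carrier_vec n" "r < m"
  shows "(A *\<^sub>v v) $ r = (\<Sum>q<n. A $$ (r, q) * v $ q)"
  using assms by (simp add: scalar_prod_def lessThan_atLeast0)

lemma mult_mat_unit_vec:
  fixes A :: "complex mat"
  assumes "A \<in> carrier_mat m n" "q < n"
  shows "A *\<^sub>v unit_vec n q = col A q"
  using assms by (intro eq_vecI) auto

lemma mult_mat_ancilla_state:
  assumes "A \<in> carrier_mat (2 ^ (n + 1)) (2 ^ (n + 1))" "q < 2 ^ n" "r < 2 ^ (n + 1)"
  shows "(A *\<^sub>v ancilla_state n q \<alpha> \<beta>) $ r = \<alpha> * A $$ (r, q) + \<beta> * A $$ (r, q + 2 ^ n)"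
proof -
  have q: "q < 2 ^ (n + 1)" "q + 2 ^ n < 2 ^ (n + 1)" using assms(2) by auto
  have "A *\<^sub>v ancilla_state n q \<alpha> \<beta> = \<alpha> \<cdot>\<^sub>v (A *\<^sub>v ket (n + 1) q) + \<beta> \<cdot>\<^sub>v (A *\<^sub>v ket (n + 1) (q + 2 ^ n))"
    unfolding ancilla_state_def using assms(1)
    by (simp add: ket_def mult_add_distrib_mat_vec[of A "2 ^ (n + 1)" "2 ^ (n + 1)"]
        mult_mat_vec[of A "2 ^ (n + 1)" "2 ^ (n + 1)"])
  then show ?thesis
    using assms q by (simp add: ket_def mult_mat_unit_vec[of A "2 ^ (n + 1)" "2 ^ (n + 1)"])
qed

lemma diagonal_ancilla_state:
  assumes "q < 2 ^ n"
  shows "diagonal (n + 1) f *\<^sub>v ancilla_state n q \<alpha> \<beta> = ancilla_state n q (f q * \<alpha>) (f (q + 2 ^ n) * \<beta>)"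
proof (rule eq_vecI)
  fix r assume "r < dim_vec (ancilla_state n q (f q * \<alpha>) (f (q + 2 ^ n) * \<beta>))"
  then have r: "r < 2 ^ (n + 1)" using ancilla_state_carrier by (metis carrier_vecD)
  show "(diagonal (n + 1) f *\<^sub>v ancilla_state n q \<alpha> \<beta>) $ r = ancilla_state n q (f q * \<alpha>) (f (q + 2 ^ n) * \<beta>) $ r"
    using assms r
    by (subst mult_mat_ancilla_state) (auto simp: diagonal_def ancilla_state_def ket_def)
qed (simp add: diagonal_def ancilla_state_def ket_def)

lemma rotation_ancilla_state:
  assumes "q < 2 ^ n"
  shows "on_qubit (n + 1) n (rotation_gate c s) *\<^sub>v ancilla_state n q \<alpha> \<beta> =
    ancilla_state n q (c * \<alpha> - cnj s * \<beta>) (s * \<alpha> + cnj c * \<beta>)"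
proof (rule eq_vecI)
  fix r assume "r < dim_vec (ancilla_state n q (c * \<alpha> - cnj s * \<beta>) (s * \<alpha> + cnj c * \<beta>))"
  then have r: "r < 2 ^ (n + 1)" using ancilla_state_carrier by (metis carrier_vecD)
  have q: "q < 2 ^ (n + 1)" "q + 2 ^ n < 2 ^ (n + 1)" using assms by auto
  have ne: "q \<noteq> q + 2 ^ n" "q + 2 ^ n \<noteq> q" by simp_all
  have "(\<forall>k<n + 1. k \<noteq> n \<longrightarrow> bit r k = bit q k) \<longleftrightarrow> r = q \<or> r = q + 2 ^ n"
    using ancilla_index_iff[of r n q] r assms by (auto simp: less_Suc_eq)
  moreover have "(\<forall>k<n + 1. k \<noteq> n \<longrightarrow> bit r k = bit (q + 2 ^ n) k) \<longleftrightarrow>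
      (\<forall>k<n + 1. k \<noteq> n \<longrightarrow> bit r k = bit q k)"
    using bit_add_power2(1)[OF assms] by (auto simp: less_Suc_eq)
  ultimately show "(on_qubit (n + 1) n (rotation_gate c s) *\<^sub>v ancilla_state n q \<alpha> \<beta>) $ r =
      ancilla_state n q (c * \<alpha> - cnj s * \<beta>) (s * \<alpha> + cnj c * \<beta>) $ r"
    using assms r q ne bit_add_power2(2)[OF assms] not_bit_if_lt_power2[OF assms]
    by (subst mult_mat_ancilla_state)
       (auto simp: on_qubit_def ancilla_state_def ket_def rotation_gate_def mat_of_rows_list_def)
qed (simp add: on_qubit_def ancilla_state_def ket_def)

lemma gate_mat_carrier: "gate_mat n g \<in> carrier_mat (2 ^ n) (2 ^ n)"
  by (cases g) (simp_all add: on_qubit_def controlled_phase_def)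

lemma circuit_mat_carrier: "circuit_mat n gs \<in> carrier_mat (2 ^ n) (2 ^ n)"
  by (induction gs) (auto intro: mult_carrier_mat gate_mat_carrier)

lemma circuit_mat_append: "circuit_mat n (gs @ hs) = circuit_mat n hs * circuit_mat n gs"
proof (induction gs)
  case Nil
  then show ?case using right_mult_one_mat[OF circuit_mat_carrier] by simp
next
  case (Cons g gs)
  then show ?case
    using assoc_mult_mat[OF circuit_mat_carrier circuit_mat_carrier gate_mat_carrier] by simp
qed

lemma circuit_append_state:
  "circuit_mat (n + 1) (gs @ hs) *\<^sub>v ancilla_state n q \<alpha> \<beta> =
   circuit_mat (n + 1) hs *\<^sub>v (circuit_mat (n + 1) gs *\<^sub>v ancilla_state n q \<alpha> \<beta>)"
  unfolding circuit_mat_append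
  by (rule assoc_mult_mat_vec[OF circuit_mat_carrier circuit_mat_carrier ancilla_state_carrier])

lemma circuit_Cons_state:
  "circuit_mat (n + 1) (g # gs) *\<^sub>v ancilla_state n q \<alpha> \<beta> =
   circuit_mat (n + 1) gs *\<^sub>v (gate_mat (n + 1) g *\<^sub>v ancilla_state n q \<alpha> \<beta>)"
  unfolding circuit_mat.simps
  by (rule assoc_mult_mat_vec[OF circuit_mat_carrier gate_mat_carrier ancilla_state_carrier])

lemma circuit_Nil_state:
  "circuit_mat (n + 1) [] *\<^sub>v ancilla_state n q \<alpha> \<beta> = ancilla_state n q \<alpha> \<beta>"
  using one_mult_mat_vec[OF ancilla_state_carrier] by simp

lemma phase_layer:
  assumes "q < 2 ^ n" "\<forall>j\<in>set js. j < n"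
  shows "circuit_mat (n + 1) (map (\<lambda>j. Single_Qubit j (phase_gate x)) js) *\<^sub>v ancilla_state n q \<alpha> \<beta> =
    ancilla_state n q (x ^ length (filter (bit q) js) * \<alpha>) (x ^ length (filter (bit q) js) * \<beta>)"
  using assms(2)
proof (induction js arbitrary: \<alpha> \<beta>)
  case Nil
  then show ?case using circuit_Nil_state by simp
next
  case (Cons j js)
  then have j: "j < n" by simp
  have "gate_mat (n + 1) (Single_Qubit j (phase_gate x)) *\<^sub>v ancilla_state n q \<alpha> \<beta> =
      ancilla_state n q ((if bit q j then x else 1) * \<alpha>) ((if bit q j then x else 1) * \<beta>)"
    using on_qubit_phase_gate[of j "n + 1" x] bit_add_power2(1)[OF assms(1) j] j
    by (simp only: gate_mat.simps diagonal_ancilla_state[OF assms(1)] trans_less_add1)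
  with Cons show ?case unfolding list.map circuit_Cons_state
    by (simp only: set_simps ball_simps) (simp add: mult_ac)
qed

text \<open>With \<open>w\<close> set bits among \<open>js\<close>, the layer multiplies the
  amplitude of \<open>|1>\<close> by \<open>z = cis \<phi> ^ w\<close>. This is the factor
  \<open>z\<close> in front of \<open>Q'\<close> in \<open>layer_stripping\<close>.\<close>

lemma controlled_phase_layer:
  assumes "q < 2 ^ n" "\<forall>j\<in>set js. j < n"
  shows "circuit_mat (n + 1) (map (\<lambda>j. Controlled_Phase j n \<phi>) js) *\<^sub>v ancilla_state n q \<alpha> \<beta> =
    ancilla_state n q \<alpha> (cis \<phi> ^ length (filter (bit q) js) * \<beta>)"
  using assms(2)
proof (induction js arbitrary: \<beta>)
  case Nil
  then show ?case using circuit_Nil_state by simp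
next
  case (Cons j js)
  then have j: "j < n" by simp
  have "gate_mat (n + 1) (Controlled_Phase j n \<phi>) *\<^sub>v ancilla_state n q \<alpha> \<beta> =
      ancilla_state n q \<alpha> ((if bit q j then cis \<phi> else 1) * \<beta>)"
    using bit_add_power2[OF assms(1)] not_bit_if_lt_power2[OF assms(1)] j
    by (simp only: gate_mat.simps controlled_phase_diagonal diagonal_ancilla_state[OF assms(1)]) simp
  with Cons show ?case unfolding list.map circuit_Cons_state
    by (simp only: set_simps ball_simps) (simp add: mult_ac)
qed

text \<open>Quantum signal processing: the ancilla amplitudes are polynomials in the phase that one layer
  of controlled phases attaches to \<open>|1\<rangle>\<close>.\<close>

lemma signal_processing_circuit:
  assumes js: "\<forall>j\<in>set js. j < n"
    and "degree P \<le> d" "degree Q \<le> d"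
    and "\<And>z. norm z = 1 \<Longrightarrow> (norm (poly P z))\<^sup>2 + (norm (poly Q z))\<^sup>2 = 1"
  shows "\<exists>gs. length gs = d * (length js + 1) + 1 \<and> (\<forall>g\<in>set gs. valid_gate (n + 1) g) \<and>
    (\<forall>q<2 ^ n. circuit_mat (n + 1) gs *\<^sub>v ancilla_state n q 1 0 =
       ancilla_state n q (poly P (cis \<phi> ^ length (filter (bit q) js)))
         (poly Q (cis \<phi> ^ length (filter (bit q) js))))"
  using assms(2-4)
proof (induction d arbitrary: P Q)
  case 0
  \<comment> \<open>A constant unit pair is the first column of a rotation, so one rotation of
    \<open>|0>\<close> prepares it.\<close>
  then obtain c s where PQ: "P = [:c:]" "Q = [:s:]" by (auto elim!: degree_eq_zeroE)
  have "complex_of_real ((norm c)\<^sup>2 + (norm s)\<^sup>2) = of_real 1" using 0(3)[of 1] by (simp add: PQ)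
  then have cs: "c * cnj c + s * cnj s = 1"
    by (simp only: of_real_add complex_norm_square of_real_1)
  have "circuit_mat (n + 1) [Single_Qubit n (rotation_gate c s)] *\<^sub>v ancilla_state n q 1 0 =
      ancilla_state n q c s" if "q < 2 ^ n" for q
    using that
    by (simp only: circuit_Cons_state gate_mat.simps rotation_ancilla_state circuit_Nil_state) simp
  then show ?case
    by (intro exI[of _ "[Single_Qubit n (rotation_gate c s)]"])
       (simp add: PQ unitary_rotation_gate[OF cs] del: circuit_mat.simps)
next
  case (Suc d)
  obtain c s P' Q' where cs: "c * cnj c + s * cnj s = 1" and deg: "degree P' \<le> d" "degree Q' \<le> d"
    and unit: "\<And>z. norm z = 1 \<Longrightarrow> (norm (poly P' z))\<^sup>2 + (norm (poly Q' z))\<^sup>2 = 1"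
    and P: "\<And>z. poly P z = c * poly P' z - cnj s * (z * poly Q' z)"
    and Q: "\<And>z. poly Q z = s * poly P' z + cnj c * (z * poly Q' z)"
    using layer_stripping[OF Suc.prems] by blast
  from Suc.IH[OF deg unit] obtain gs where gs: "length gs = d * (length js + 1) + 1"
    "\<forall>g\<in>set gs. valid_gate (n + 1) g"
    "\<And>q. q < 2 ^ n \<Longrightarrow> circuit_mat (n + 1) gs *\<^sub>v ancilla_state n q 1 0 =
       ancilla_state n q (poly P' (cis \<phi> ^ length (filter (bit q) js)))
         (poly Q' (cis \<phi> ^ length (filter (bit q) js)))"
    by blast
  \<comment> \<open>Each degree costs one layer of \<open>length js\<close> controlled phases and
    one rotation; the base rotation is the extra \<open>1\<close> in the count.\<close>
  define hs where "hs = gs @ map (\<lambda>j. Controlled_Phase j n \<phi>) js @ [Single_Qubit n (rotation_gate c s)]"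
  have "length hs = Suc d * (length js + 1) + 1" by (simp add: hs_def gs(1))
  moreover have "\<forall>g\<in>set hs. valid_gate (n + 1) g"
    using gs(2) js unitary_rotation_gate[OF cs] by (auto simp: hs_def)
  moreover have "circuit_mat (n + 1) hs *\<^sub>v ancilla_state n q 1 0 =
       ancilla_state n q (poly P (cis \<phi> ^ length (filter (bit q) js)))
         (poly Q (cis \<phi> ^ length (filter (bit q) js)))" if "q < 2 ^ n" for q
    unfolding hs_def circuit_append_state gs(3)[OF that] controlled_phase_layer[OF that js]
      circuit_Cons_state gate_mat.simps rotation_ancilla_state[OF that] circuit_Nil_state P Q ..
  ultimately show ?case by blast
qed

section \<open>The sign of a sum of Pauli-Z operators\<close>

lemma z_value_eq:
  assumes S: "S \<subseteq> {..<n}" and q: "q < 2 ^ n"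
  shows "z_value n S q = int (card S) - 2 * int (card {j \<in> S. bit q j})"
proof -
  have fin: "finite S" using S finite_subset by blast
  define z where "z = int (card S) - 2 * int (card {j \<in> S. bit q j})"
  have Zket: "pauli_Z n j *\<^sub>v ket n q = (if bit q j then -1 else 1) \<cdot>\<^sub>v ket n q" if "j \<in> S" for j
  proof -
    have "j < n" using that S by auto
    then have Z: "pauli_Z n j = diagonal n (\<lambda>q. if bit q j then -1 else 1)"
      unfolding pauli_Z_def phase_gate_def[symmetric] by (rule on_qubit_phase_gate)
    show ?thesis
      unfolding Z ket_def using q
      by (subst mult_mat_unit_vec[of _ "2 ^ n" "2 ^ n"]) (auto simp: diagonal_def intro!: eq_vecI)
  qed
  have "(\<Sum>j\<in>S. if bit q j then -1 else 1 :: int) = (\<Sum>j\<in>S. 1 - 2 * of_bool (bit q j))"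
    by (rule sum.cong) auto
  also have "\<dots> = z"
    using fin by (simp add: z_def sum_subtractf sum_distrib_left[symmetric] Int_def conj_commute)
  finally have "of_int (\<Sum>j\<in>S. if bit q j then -1 else 1 :: int) = (of_int z :: complex)" by simp
  then have sum: "(\<Sum>j\<in>S. if bit q j then -1 else 1 :: complex) = of_int z"
    by (simp add: if_distrib cong: if_cong)
  have "finsum_vec TYPE(complex) (2 ^ n) (\<lambda>j. pauli_Z n j *\<^sub>v ket n q) S = of_int z \<cdot>\<^sub>v ket n q"
    (is "?v = _")
  proof (rule eq_vecI)
    have car: "(\<lambda>j. pauli_Z n j *\<^sub>v ket n q) \<in> S \<rightarrow> carrier_vec (2 ^ n)"
      using Zket by (auto simp: ket_def)
    then show "dim_vec ?v = dim_vec (of_int z \<cdot>\<^sub>v ket n q)"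
      using carrier_vecD[OF finsum_vec_closed[OF car]] by (simp add: ket_def)
    fix r assume "r < dim_vec (of_int z \<cdot>\<^sub>v ket n q)"
    then have r: "r < 2 ^ n" by (simp add: ket_def)
    have "?v $ r = (\<Sum>j\<in>S. (pauli_Z n j *\<^sub>v ket n q) $ r)"
      by (rule index_finsum_vec[OF fin r car])
    also have "\<dots> = (\<Sum>j\<in>S. (if bit q j then -1 else 1) * ket n q $ r)"
      by (intro sum.cong refl, subst Zket) (use r in \<open>auto simp: ket_def\<close>)
    also have "\<dots> = of_int z * ket n q $ r"
      by (simp only: sum_distrib_right[symmetric] sum)
    finally show "?v $ r = (of_int z \<cdot>\<^sub>v ket n q) $ r" using r by (simp add: ket_def)
  qed
  \<comment> \<open>Entry \<open>q\<close> of \<open>ket n q\<close> is \<open>1\<close>, so the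
    eigenvalue is unique and \<open>THE\<close> denotes it.\<close>
  moreover have "z' = z" if "of_int z \<cdot>\<^sub>v ket n q = (of_int z' :: complex) \<cdot>\<^sub>v ket n q" for z'
    using arg_cong[OF that, of "\<lambda>v :: complex Matrix.vec. v $ q"] q by (simp add: ket_def)
  ultimately show ?thesis
    unfolding z_value_def z_def[symmetric] by (intro the_equality) auto
qed

text \<open>The action on basis states with ancilla \<open>|0>\<close> fixes the first
  \<open>2 ^ n\<close> columns of the circuit matrix. These suffice, since a padded vector vanishes
  at all other indices.\<close>

lemma implementsI:
  assumes valid: "\<forall>g\<in>set gs. valid_gate (n + 1) g"
    and state: "\<And>q. q < 2 ^ n \<Longrightarrow>
      circuit_mat (n + 1) gs *\<^sub>v ancilla_state n q 1 0 = ancilla_state n q (f q) 0"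
  shows "implements n 1 gs (diagonal n f)"
  unfolding implements_def
proof (intro conjI ballI)
  fix \<psi> :: "complex vec" assume \<psi>: "\<psi> \<in> carrier_vec (2 ^ n)"
  define C where "C = circuit_mat (n + 1) gs"
  have C: "C \<in> carrier_mat (2 ^ (n + 1)) (2 ^ (n + 1))" unfolding C_def by (rule circuit_mat_carrier)
  have entry: "C $$ (r, q) = (if r = q then f q else 0)" if qr: "q < 2 ^ n" "r < 2 ^ (n + 1)" for r q
  proof -
    have "C $$ (r, q) = (C *\<^sub>v ancilla_state n q 1 0) $ r"
      by (simp only: mult_mat_ancilla_state[OF C qr]) simp
    also have "\<dots> = ancilla_state n q (f q) 0 $ r"
      by (simp only: C_def state[OF qr(1)])
    also have "\<dots> = (if r = q then f q else 0)"
      using qr by (simp add: ancilla_state_def ket_def)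
    finally show ?thesis .
  qed
  let ?\<phi> = "\<psi> @\<^sub>v 0\<^sub>v (2 ^ (n + 1) - 2 ^ n)"
  have \<phi>: "?\<phi> \<in> carrier_vec (2 ^ (n + 1))" using \<psi> by (intro carrier_vecI) simp
  show "C *\<^sub>v ?\<phi> = (diagonal n f *\<^sub>v \<psi>) @\<^sub>v 0\<^sub>v (2 ^ (n + 1) - 2 ^ n)"
  proof (rule eq_vecI)
    fix r assume "r < dim_vec ((diagonal n f *\<^sub>v \<psi>) @\<^sub>v 0\<^sub>v (2 ^ (n + 1) - 2 ^ n))"
    then have r: "r < 2 ^ (n + 1)" by (simp add: diagonal_def)
    have "(C *\<^sub>v ?\<phi>) $ r = (\<Sum>q<2 ^ (n + 1). C $$ (r, q) * ?\<phi> $ q)"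
      by (rule index_mult_mat_vec_sum[OF C \<phi> r])
    also have "\<dots> = (\<Sum>q<2 ^ n. C $$ (r, q) * ?\<phi> $ q)"
      using \<psi> by (intro sum.mono_neutral_right) auto
    also have "\<dots> = (\<Sum>q<2 ^ n. if q = r then f r * \<psi> $ r else 0)"
      using \<psi> by (intro sum.cong refl) (auto simp: entry[OF _ r])
    also have "\<dots> = (if r < 2 ^ n then f r * \<psi> $ r else 0)" by simp
    also have "\<dots> = ((diagonal n f *\<^sub>v \<psi>) @\<^sub>v 0\<^sub>v (2 ^ (n + 1) - 2 ^ n)) $ r"
    proof (cases "r < 2 ^ n")
      case True
      have "(diagonal n f *\<^sub>v \<psi>) $ r = (\<Sum>q<2 ^ n. diagonal n f $$ (r, q) * \<psi> $ q)"
        by (rule index_mult_mat_vec_sum[OF _ \<psi> True]) (simp add: diagonal_def)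
      also have "\<dots> = (\<Sum>q<2 ^ n. if q = r then f r * \<psi> $ r else 0)"
        using True by (intro sum.cong refl) (auto simp: diagonal_def)
      finally show ?thesis using True by (simp add: diagonal_def)
    next
      case False
      then show ?thesis using r by (simp add: diagonal_def)
    qed
    finally show "(C *\<^sub>v ?\<phi>) $ r = ((diagonal n f *\<^sub>v \<psi>) @\<^sub>v 0\<^sub>v (2 ^ (n + 1) - 2 ^ n)) $ r" .
  qed (use C in \<open>simp add: diagonal_def\<close>)
qed (use valid in auto)

lemma identity_padding:
  assumes "q < 2 ^ n"
  shows "circuit_mat (n + 1) (replicate m (Single_Qubit n (rotation_gate 1 0))) *\<^sub>v ancilla_state n q \<alpha> \<beta> =
    ancilla_state n q \<alpha> \<beta>"
proof (induction m)
  case 0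
  then show ?case using circuit_Nil_state by simp
next
  case (Suc m)
  then show ?case
    unfolding replicate_Suc circuit_Cons_state gate_mat.simps rotation_ancilla_state[OF assms] by simp
qed

text \<open>As \<open>card S = 2 * h - 1\<close>, the number \<open>w\<close> of set bits stays
  below \<open>2 * h\<close>, the range of the interpolation, and \<open>h\<close> is the majority
  threshold. Phase gates on the data qubits turn the amplitude \<open>P\<close> into the
  sign.\<close>

lemma sign_Z_circuit:
  assumes S: "S \<subseteq> {..<n}" and card: "card S = 2 * h - 1" and h: "h > 0"
    and K: "card S * (card S + 1) \<le> K"
  shows "\<exists>gs. length gs = K \<and> implements n 1 gs (sign_Z n S)"
proof -
  have fin: "finite S" using S finite_subset by blast
  define js where "js = sorted_list_of_set S"
  have js: "set js = S" "distinct js" "length js = card S" "\<forall>j\<in>set js. j < n"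
    using fin S by (auto simp: js_def)
  have len: "length (filter (bit q) js) = card {j \<in> S. bit q j}" for q
    using distinct_length_filter[OF js(2), of "bit q"] js(1) by (simp add: Int_def conj_commute)
  have le: "card {j \<in> S. bit q j} < 2 * h" for q
  proof -
    have "card {j \<in> S. bit q j} \<le> card S" by (rule card_mono[OF fin]) auto
    then show ?thesis using card h by linarith
  qed
  obtain P where P: "degree P \<le> 2 * (h - 1)" "\<And>z. norm z = 1 \<Longrightarrow> norm (poly P z) \<le> 1"
    "\<And>w. w < 2 * h \<Longrightarrow> cis (pi / real h) ^ w * poly P (cis (2 * pi / real h) ^ w) =
              (if w < h then 1 else -1)"
    using sign_interpolating_polynomial[OF h] by blast
  obtain Q where Q: "degree Q \<le> 2 * (h - 1)"
    "\<And>z. norm z = 1 \<Longrightarrow> (norm (poly P z))\<^sup>2 + (norm (poly Q z))\<^sup>2 = 1"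
    using unitary_completion[OF P(1,2)] by blast
  \<comment> \<open>At the nodes \<open>|P| = 1\<close>, which leaves no amplitude on
    \<open>|1>\<close>: the ancilla returns to \<open>|0>\<close>.\<close>
  have Q0: "poly Q (cis (2 * pi / real h) ^ w) = 0" if "w < 2 * h" for w
  proof -
    have "norm (cis (pi / real h) ^ w * poly P (cis (2 * pi / real h) ^ w)) = 1"
      unfolding P(3)[OF that] by simp
    then have "norm (poly P (cis (2 * pi / real h) ^ w)) = 1"
      by (simp add: norm_mult norm_power)
    then show ?thesis
      using Q(2)[of "cis (2 * pi / real h) ^ w"] by (simp add: norm_power)
  qed
  obtain gs where gs: "length gs = 2 * (h - 1) * (length js + 1) + 1"
    "\<forall>g\<in>set gs. valid_gate (n + 1) g"
    "\<And>q. q < 2 ^ n \<Longrightarrow> circuit_mat (n + 1) gs *\<^sub>v ancilla_state n q 1 0 =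
       ancilla_state n q (poly P (cis (2 * pi / real h) ^ length (filter (bit q) js)))
         (poly Q (cis (2 * pi / real h) ^ length (filter (bit q) js)))"
    using signal_processing_circuit[OF js(4) P(1) Q, of "2 * pi / real h"] by blast
  define pad where "pad = replicate (K - card S * (card S + 1)) (Single_Qubit n (rotation_gate 1 0))"
  define hs where "hs = gs @ map (\<lambda>j. Single_Qubit j (phase_gate (cis (pi / real h)))) js @ pad"
  \<comment> \<open>With \<open>L = card S\<close>: \<open>L - 1\<close> rounds of
    \<open>L + 1\<close> gates, the initial rotation and \<open>L\<close> phase gates make
    \<open>L^2 + L\<close>.\<close>
  have "2 * (h - 1) * (card S + 1) + 1 + card S = card S * (card S + 1)"
    using h unfolding card by (cases h) (simp_all add: algebra_simps)
  then have "length hs = K" using K by (simp add: hs_def pad_def gs(1) js(3))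
  moreover have "implements n 1 hs (sign_Z n S)"
  proof -
    have "cis (pi / real h) * cnj (cis (pi / real h)) = 1" by (simp add: inverse_unit_circle)
    then have valid: "\<forall>g\<in>set hs. valid_gate (n + 1) g"
      using gs(2) js(4) unitary_phase_gate unitary_rotation_gate[of 1 0]
      by (auto simp: hs_def pad_def)
    \<comment> \<open>For \<open>w\<close> set bits the eigenvalue is
      \<open>2 * h - 1 - 2 * w\<close>: odd, hence nonzero, and positive exactly for
      \<open>w < h\<close>.\<close>
    have sgn: "sign_Z n S = diagonal n (\<lambda>q. if card {j \<in> S. bit q j} < h then 1 else -1)"
      unfolding sign_Z_def diagonal_def
    proof (rule cong_mat[OF refl refl])
      fix r q :: nat assume "r < 2 ^ n" "q < 2 ^ n"
      then show "(case (r, q) of (r, q) \<Rightarrow> if r = q then if z_value n S q > 0 then 1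
            else if z_value n S q < 0 then -1 else 0 else 0) =
          (case (r, q) of (r, c) \<Rightarrow> if r = c then if card {j \<in> S. bit r j} < h then 1 else -1 else (0 :: complex))"
        using z_value_eq[OF S, of q] card h by auto
    qed
    show ?thesis
      unfolding sgn
    proof (rule implementsI[OF valid])
      fix q :: nat assume q: "q < 2 ^ n"
      show "circuit_mat (n + 1) hs *\<^sub>v ancilla_state n q 1 0 =
          ancilla_state n q (if card {j \<in> S. bit q j} < h then 1 else -1) 0"
        unfolding hs_def circuit_append_state gs(3)[OF q] phase_layer[OF q js(4)] pad_def
          identity_padding[OF q] len Q0[OF le] P(3)[OF le] by simp
    qed
  qed
  ultimately show ?thesis by blast
qed


section \<open>The degree-\<open>D\<close> code\<close>

text \<open>\<open>LEAST\<close> is meaningful: a prime above both \<open>code_length D F M\<close>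
  and \<open>M\<close> qualifies, since \<open>p \<le> p ^ (D + 1)\<close>.\<close>

lemma block_size_prime_ge:
  "prime (block_size D F M)" "code_length D F M \<le> block_size D F M"
proof -
  obtain p where p: "prime p" "max (code_length D F M) M < p" using bigger_prime by blast
  then have "M \<le> p ^ (D + 1)"
    using self_le_power[of p "D + 1"] prime_ge_1_nat[OF p(1)] by linarith
  with p have "prime p \<and> code_length D F M \<le> p \<and> M \<le> p ^ (D + 1)" by auto
  from LeastI[of "\<lambda>p. prime p \<and> code_length D F M \<le> p \<and> M \<le> p ^ (D + 1)", OF this]
  show "prime (block_size D F M)" "code_length D F M \<le> block_size D F M"
    unfolding block_size_def by blast+
qed

lemma codeword_support_subset: "codeword_support D F M y i \<subseteq> {..<num_qubits D F M}"
  by (auto simp: codeword_support_def elementary_codeword_def)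

text \<open>Each of the \<open>code_length D F M\<close> blocks holds exactly one qubit of the
  support.\<close>

lemma card_codeword_support:
  assumes code: "degree_code D F M y" and i: "i < M"
  shows "card (codeword_support D F M y i) = code_length D F M"
proof -
  define p where "p = block_size D F M"
  define L where "L = code_length D F M"
  have p: "p > 0" "L \<le> p"
    using block_size_prime_ge[of D F M] prime_gt_0_nat by (auto simp: p_def L_def)
  have "y i \<in> polynomial_functions D p"
    using code i by (auto simp: degree_code_def p_def)
  then obtain P :: "int poly" where "y i = (\<lambda>x\<in>{..<p}. nat (poly P (int x) mod int p))"
    by (auto simp: polynomial_functions_def)
  \<comment> \<open>As \<open>L \<le> p\<close>, block numbers lie in the restricted domain
    \<open>{..<p}\<close>, so the value is a residue and not the default of
    \<open>restrict\<close>.\<close>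
  then have lt: "y i x < p" if "x < L" for x
    using that p by (simp add: nat_less_iff)
  have "codeword_support D F M y i = (\<lambda>x. x * p + y i x) ` {..<L}"
  proof (intro equalityI subsetI)
    fix j assume "j \<in> codeword_support D F M y i"
    then have j: "j < L * p" "y i (j div p) = j mod p"
      by (auto simp: codeword_support_def elementary_codeword_def num_qubits_def p_def L_def mult.commute)
    then have "j div p < L" using p(1) by (simp add: div_less_iff_less_mult)
    moreover have "j = (j div p) * p + y i (j div p)" unfolding j(2) by simp
    ultimately show "j \<in> (\<lambda>x. x * p + y i x) ` {..<L}" by blast
  next
    fix j assume "j \<in> (\<lambda>x. x * p + y i x) ` {..<L}"
    then obtain x where x: "x < L" "j = x * p + y i x" by blast
    have "j < (x + 1) * p" using x lt[OF x(1)] by simp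
    also have "\<dots> \<le> L * p" using x(1) by (intro mult_right_mono) auto
    finally have "j < p * L" by (simp only: mult.commute)
    moreover have "j div p = x" "j mod p = y i x" using x lt[OF x(1)] by auto
    ultimately show "j \<in> codeword_support D F M y i"
      by (simp add: codeword_support_def elementary_codeword_def num_qubits_def p_def[symmetric] L_def[symmetric])
  qed
  moreover have "inj_on (\<lambda>x. x * p + y i x) {..<L}"
  proof (rule inj_on_inverseI[of _ "\<lambda>j. j div p"])
    fix x assume "x \<in> {..<L}"
    then show "(x * p + y i x) div p = x" using lt[of x] by simp
  qed
  ultimately show ?thesis by (simp add: card_image L_def)
qed

section \<open>The gate count and its growth\<close>

lemma gate_count_eq:
  "code_length D F M * (2 * code_length D F M - 1) =
     8 * D ^ 2 * F ^ 2 * nat \<lceil>log 2 (real M + 1)\<rceil> ^ 2 + 6 * D * F * nat \<lceil>log 2 (real M + 1)\<rceil> + 1"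
  by (simp add: code_length_def algebra_simps power2_eq_square)

text \<open>The ceiling is at most \<open>log 2 (M + 1) + 1 \<le> log 2 M + 2\<close>, and
  \<open>log 2 M \<ge> 1\<close> absorbs the \<open>2\<close>.\<close>

lemma ceiling_log_bounds:
  shows "M > 0 \<Longrightarrow> nat \<lceil>log 2 (real M + 1)\<rceil> \<ge> 1"
    and "M \<ge> 2 \<Longrightarrow> real (nat \<lceil>log 2 (real M + 1)\<rceil>) \<le> 3 * log 2 (real M)"
proof -
  have ge: "1 \<le> log 2 x" if "x \<ge> 2" for x :: real
    using that by (simp add: le_log_iff)
  show "nat \<lceil>log 2 (real M + 1)\<rceil> \<ge> 1" if "M > 0"
    using ge[of "real M + 1"] that by linarith
  show "real (nat \<lceil>log 2 (real M + 1)\<rceil>) \<le> 3 * log 2 (real M)" if M: "M \<ge> 2"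
  proof -
    have "log 2 (real M + 1) \<le> log 2 (2 * real M)" using M by simp
    also have "\<dots> = 1 + log 2 (real M)" using M by (simp add: log_mult)
    finally show ?thesis
      using ge[of "real M"] M ge[of "real M + 1"] by linarith
  qed
qed

text \<open>The principal filter makes the bound uniform over all its triples. At
  \<open>M = 1\<close> the logarithm is \<open>0\<close> while the count is positive, hence
  \<open>M \<ge> 2\<close>.\<close>

lemma gate_count_bigo:
  "(\<lambda>(D, F, M). real (code_length D F M * (2 * code_length D F M - 1)))
     \<in> O[principal {(D, F, M). D > 0 \<and> F > 0 \<and> M \<ge> 2}](\<lambda>(D, F, M).
          real D ^ 2 * real F ^ 2 * log 2 (real M) ^ 2)"
\<comment> \<open>\<open>135 = 15 * 3^2\<close>: the coefficients \<open>8 + 6 + 1\<close> merge for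
  \<open>x \<ge> 1\<close>, and the factor \<open>3\<close> of the ceiling bound is squared.\<close>
proof (rule bigoI[of _ 135], unfold eventually_principal, clarify)
  fix D F M :: nat assume pos: "D > 0" "F > 0" "M \<ge> 2"
  define k where "k = nat \<lceil>log 2 (real M + 1)\<rceil>"
  define x where "x = D * F * k"
  have k: "k \<ge> 1" "real k \<le> 3 * log 2 (real M)"
    using ceiling_log_bounds[of M] pos by (auto simp: k_def)
  then have x1: "x \<ge> 1" using pos by (simp add: x_def Suc_leI)
  have x2: "real x \<le> real D * real F * (3 * log 2 (real M))"
    unfolding x_def of_nat_mult using k(2) by (intro mult_left_mono) auto
  have "code_length D F M * (2 * code_length D F M - 1) = 8 * x\<^sup>2 + 6 * x + 1"
    unfolding gate_count_eq k_def[symmetric] x_def by (simp add: power_mult_distrib mult_ac)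
  also have "\<dots> \<le> 15 * x\<^sup>2"
    using x1 self_le_power[of x 2] one_le_power[of x 2] by linarith
  finally have "real (code_length D F M * (2 * code_length D F M - 1)) \<le> real (15 * x\<^sup>2)"
    by (simp only: of_nat_le_iff)
  also have "\<dots> = 15 * (real x)\<^sup>2" by simp
  also have "\<dots> \<le> 15 * (real D * real F * (3 * log 2 (real M)))\<^sup>2"
    using x2 by (intro mult_left_mono power_mono) auto
  also have "\<dots> = 135 * (real D ^ 2 * real F ^ 2 * log 2 (real M) ^ 2)"
    by (simp add: power_mult_distrib)
  finally show "norm (real (code_length D F M * (2 * code_length D F M - 1)))
      \<le> 135 * norm (real D ^ 2 * real F ^ 2 * log 2 (real M) ^ 2)"
    by simp
qed

theorem theorem2:
  fixes D F M i :: nat and y :: "nat \<Rightarrow> nat \<Rightarrow> nat"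
  assumes "D > 0" and "F > 0" and "M > 0"
    and "degree_code D F M y"
    and "i < M"
  shows
    "(\<exists>gs. length gs = code_length D F M * (2 * code_length D F M - 1) \<and>
           implements (num_qubits D F M) 1 gs (encoded_Z D F M y i)) \<and>
     code_length D F M * (2 * code_length D F M - 1) =
       8 * D ^ 2 * F ^ 2 * nat \<lceil>log 2 (real M + 1)\<rceil> ^ 2 +
       6 * D * F * nat \<lceil>log 2 (real M + 1)\<rceil> + 1 \<and>
     (\<lambda>(D, F, M). real (code_length D F M * (2 * code_length D F M - 1)))
       \<in> O[principal {(D, F, M). D > 0 \<and> F > 0 \<and> M \<ge> 2}](\<lambda>(D, F, M).
            real D ^ 2 * real F ^ 2 * log 2 (real M) ^ 2)"
proof (intro conjI gate_count_eq gate_count_bigo)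
  define x where "x = D * F * nat \<lceil>log 2 (real M + 1)\<rceil>"
  have L: "code_length D F M = 2 * x + 1" by (simp add: code_length_def x_def)
  \<comment> \<open>This gives \<open>L \<ge> 3\<close>, so \<open>L + 1 \<le> 2 * L - 1\<close> and
    the circuit fits into the stated count.\<close>
  have "x \<ge> 1" using assms(1,2) ceiling_log_bounds(1)[OF assms(3)] by (simp add: x_def Suc_leI)
  then have "code_length D F M * (code_length D F M + 1)
      \<le> code_length D F M * (2 * code_length D F M - 1)"
    unfolding L by (intro mult_left_mono) auto
  then show "\<exists>gs. length gs = code_length D F M * (2 * code_length D F M - 1) \<and>
      implements (num_qubits D F M) 1 gs (encoded_Z D F M y i)"
    unfolding encoded_Z_def
    by (intro sign_Z_circuit[OF codeword_support_subset, where h = "x + 1"])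
       (simp_all add: card_codeword_support[OF assms(4,5)] L)
qed

end
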